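(* Let $A$ and $B$ be strictly positive operators on a Hilbert space $H$ such that $uA\le B\le vA$ for real numbers $u,v>0$ with $u\ge 1$, and let $-1\le p<1$ with $p\neq 0$. Then $$\frac{T_p(A|B)-T_{p-1}(A|B)}{2}\ \le\ 4\left\{T_p\!\left(A\,\Big|\,\frac{A+B}{2}\right)-T_{p-1}\!\left(A\,\Big|\,\frac{A+B}{2}\right)\right\}\ \le\ \frac{T_p(A|B)-T_1(A|B)}{p-1}\ \le\ \frac{T_p(A|B)-T_{p-1}(A|B)}{2}+\frac{A\natural_2(B-A)}{4}.$$
   Context: An operator $A\in B(H)$ (bounded linear operators on a Hilbert space $H$) is strictly positive, $A>0$, if $A\ge 0$ and $A$ is invertible. For self-adjoint $X,Y$, $X\le Y$ means $Y-X$ is positive semidefinite. Powers are taken by functional calculus. For $A,B>0$ and real $r\ne 0$, the Tsallis relative operator entropy is $T_r(A|B)=\dfrac{A\natural_rB-A}{r}$, where $A\natural_rB=A^{1/2}(A^{-1/2}BA^{-1/2})^rA^{1/2}$. The same formula with $r=2$ is used for $A\natural_2(B-A)$, i.e. $A\natural_2(B-A)=A^{1/2}\left(A^{-1/2}(B-A)A^{-1/2}\right)^2A^{1/2}$ (where $B-A\ge0$ need not be invertible). *)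

theory Defs
  imports "HOL-Analysis.Analysis" "HOL-Computational_Algebra.Polynomial"
begin

text \<open>
  Complex Hilbert spaces, built over the real Hilbert structure obtained by restricting scalars.
  The inner product is linear in its first argument. Positive definiteness and
  \<open>norm x = sqrt (Re (cinner x x))\<close> are inherited from \<^class>\<open>real_inner\<close> through
  \<open>inner_eq_Re_cinner\<close>.
\<close>

class complex_hilbert_space = real_inner + complete_space +
  fixes scaleC :: "complex \<Rightarrow> 'a \<Rightarrow> 'a"  (infixr "*\<^sub>C" 75)
    and cinner :: "'a \<Rightarrow> 'a \<Rightarrow> complex"
  assumes scaleC_add_right: "c *\<^sub>C (x + y) = c *\<^sub>C x + c *\<^sub>C y"
    and scaleC_add_left: "(c + d) *\<^sub>C x = c *\<^sub>C x + d *\<^sub>C x"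
    and scaleC_scaleC: "c *\<^sub>C d *\<^sub>C x = (c * d) *\<^sub>C x"
    and scaleC_of_real: "complex_of_real r *\<^sub>C x = r *\<^sub>R x"
    and cinner_commute: "cinner x y = cnj (cinner y x)"
    and cinner_add_left: "cinner (x + y) z = cinner x z + cinner y z"
    and cinner_scaleC_left: "cinner (c *\<^sub>C x) y = c * cinner x y"
    and inner_eq_Re_cinner: "inner x y = Re (cinner x y)"

instantiation complex :: complex_hilbert_space
begin

definition scaleC_complex :: "complex \<Rightarrow> complex \<Rightarrow> complex"
  where "scaleC_complex c x = c * x"

definition cinner_complex :: "complex \<Rightarrow> complex \<Rightarrow> complex"
  where "cinner_complex x y = x * cnj y"

instance
  by standard
    (simp_all add: scaleC_complex_def cinner_complex_def inner_complex_def scaleR_conv_of_real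
      algebra_simps)

end

lemma norm_scaleC: "norm (c *\<^sub>C x) = cmod c * norm x"
  for x :: "'a :: complex_hilbert_space"
proof -
  have "cinner (c *\<^sub>C x) (c *\<^sub>C x) = c * cnj (c * cinner x x)"
    by (metis cinner_commute cinner_scaleC_left)
  also have "\<dots> = complex_of_real ((cmod c)\<^sup>2) * cinner x x"
    using cinner_commute[of x x] unfolding complex_norm_square by (simp add: mult_ac)
  finally have "inner (c *\<^sub>C x) (c *\<^sub>C x) = (cmod c)\<^sup>2 * inner x x"
    by (simp add: inner_eq_Re_cinner)
  then show ?thesis
    by (simp add: norm_eq_sqrt_inner real_sqrt_mult)
qed

text \<open>
  The algebra \<open>B(H)\<close> is the set of those bounded real-linear maps that are complex-linear;
  the operator norm is that of \<^typ>\<open>'a \<Rightarrow>\<^sub>L 'a\<close>.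
\<close>

definition bounded_operators :: "('a :: complex_hilbert_space \<Rightarrow>\<^sub>L 'a) set"
  where "bounded_operators = {A :: 'a \<Rightarrow>\<^sub>L 'a. \<forall>c x. A (c *\<^sub>C x) = c *\<^sub>C A x}"

definition selfadjoint_op :: "('a :: complex_hilbert_space \<Rightarrow>\<^sub>L 'a) \<Rightarrow> bool"
  where "selfadjoint_op A \<longleftrightarrow>
    A \<in> bounded_operators \<and> (\<forall>x y. cinner (A x) y = cinner x (A y))"

definition positive_op :: "('a :: complex_hilbert_space \<Rightarrow>\<^sub>L 'a) \<Rightarrow> bool"
  where "positive_op A \<longleftrightarrow> selfadjoint_op A \<and> (\<forall>x. 0 \<le> Re (cinner (A x) x))"

definition invertible_op :: "('a :: complex_hilbert_space \<Rightarrow>\<^sub>L 'a) \<Rightarrow> bool"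
  where "invertible_op A \<longleftrightarrow>
    (\<exists>C \<in> bounded_operators. A o\<^sub>L C = id_blinfun \<and> C o\<^sub>L A = id_blinfun)"

definition strictly_positive_op :: "('a :: complex_hilbert_space \<Rightarrow>\<^sub>L 'a) \<Rightarrow> bool"
  where "strictly_positive_op A \<longleftrightarrow> positive_op A \<and> invertible_op A"

definition loewner_le ::
    "('a :: complex_hilbert_space \<Rightarrow>\<^sub>L 'a) \<Rightarrow> ('a \<Rightarrow>\<^sub>L 'a) \<Rightarrow> bool"  (infix "\<preceq>" 50)
  where "X \<preceq> Y \<longleftrightarrow> selfadjoint_op X \<and> selfadjoint_op Y \<and> positive_op (Y - X)"

lift_definition scalar_op :: "complex \<Rightarrow> 'a :: complex_hilbert_space \<Rightarrow>\<^sub>L 'a"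
  is "\<lambda>c x. c *\<^sub>C x"
proof
  fix c r and x y :: 'a
  show "c *\<^sub>C (x + y) = c *\<^sub>C x + c *\<^sub>C y"
    by (rule scaleC_add_right)
  show "c *\<^sub>C r *\<^sub>R x = r *\<^sub>R c *\<^sub>C x"
    by (simp add: scaleC_of_real[symmetric] scaleC_scaleC mult.commute)
  show "\<exists>K. \<forall>x :: 'a. norm (c *\<^sub>C x) \<le> norm x * K"
    by (metis norm_scaleC mult.commute order_refl)
qed

definition op_spectrum :: "('a :: complex_hilbert_space \<Rightarrow>\<^sub>L 'a) \<Rightarrow> complex set"
  where "op_spectrum A = {z. \<not> invertible_op (A - scalar_op z)}"

definition op_poly ::
    "real poly \<Rightarrow> ('a :: complex_hilbert_space \<Rightarrow>\<^sub>L 'a) \<Rightarrow> ('a \<Rightarrow>\<^sub>L 'a)"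
  where "op_poly q A = (\<Sum>i\<le>degree q. coeff q i *\<^sub>R ((\<lambda>T. A o\<^sub>L T) ^^ i) id_blinfun)"

text \<open>
  Continuous functional calculus of a self-adjoint operator: \<open>f(A)\<close> is the norm limit of
  \<open>q\<^sub>n(A)\<close>, where the polynomials \<open>q\<^sub>n\<close> converge to \<open>f\<close> uniformly on the spectrum of \<open>A\<close>.
  The spectrum is real, so real polynomials suffice for real-valued \<open>f\<close>. The value is meaningful
  only if \<open>A\<close> is self-adjoint and \<open>f\<close> is continuous on the spectrum.
\<close>

definition fun_calc ::
    "(real \<Rightarrow> real) \<Rightarrow> ('a :: complex_hilbert_space \<Rightarrow>\<^sub>L 'a) \<Rightarrow> ('a \<Rightarrow>\<^sub>L 'a)"
  where "fun_calc f A = (THE T. \<exists>q :: nat \<Rightarrow> real poly.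
    uniform_limit {t. complex_of_real t \<in> op_spectrum A} (\<lambda>n. poly (q n)) f sequentially \<and>
    (\<lambda>n. op_poly (q n) A) \<longlonglongrightarrow> T)"

text \<open>
  Since \<open>0 powr r = 0\<close>, the map \<open>t \<mapsto> t powr r\<close> is continuous on \<open>[0, \<infinity>)\<close> for \<open>r > 0\<close>, so
  positive powers make sense for all positive operators; other powers require strict positivity.
\<close>

definition op_powr :: "('a :: complex_hilbert_space \<Rightarrow>\<^sub>L 'a) \<Rightarrow> real \<Rightarrow> ('a \<Rightarrow>\<^sub>L 'a)"
  where "op_powr A r = fun_calc (\<lambda>t. t powr r) A"

definition op_natural ::
    "real \<Rightarrow> ('a :: complex_hilbert_space \<Rightarrow>\<^sub>L 'a) \<Rightarrow> ('a \<Rightarrow>\<^sub>L 'a) \<Rightarrow> ('a \<Rightarrow>\<^sub>L 'a)"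
  where "op_natural r A B =
    op_powr A (1/2) o\<^sub>L
    op_powr (op_powr A (- (1/2)) o\<^sub>L B o\<^sub>L op_powr A (- (1/2))) r o\<^sub>L
    op_powr A (1/2)"

definition tsallis ::
    "real \<Rightarrow> ('a :: complex_hilbert_space \<Rightarrow>\<^sub>L 'a) \<Rightarrow> ('a \<Rightarrow>\<^sub>L 'a) \<Rightarrow> ('a \<Rightarrow>\<^sub>L 'a)"
  where "tsallis r A B = (op_natural r A B - A) /\<^sub>R r"

end

theory Submission
  imports Defs "HOL-Computational_Algebra.Fundamental_Theorem_Algebra"
begin

text \<open>
  Put \<open>R = A\<^sup>1\<^sup>/\<^sup>2\<close> and \<open>C = R\<^sup>-\<^sup>1 B R\<^sup>-\<^sup>1\<close>. Every operator in the statement has the form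
  \<open>R f(C) R\<close>, and \<open>u \<ge> 1\<close> puts the spectrum of \<open>C\<close> into \<open>[1, \<infinity>)\<close>. So it suffices to compare
  the scalar functions \<open>f\<close> on \<open>t \<ge> 1\<close>. With \<open>ln\<^sub>r t = (t\<^sup>r - 1) / r\<close> one has
  \<open>ln\<^sub>p t - ln\<^sub>p\<^sub>-\<^sub>1 t = \<integral>\<^sub>1\<^sup>t (s - 1) s\<^sup>p\<^sup>-\<^sup>2 ds\<close>, while the third expression is
  \<open>\<integral>\<^sub>1\<^sup>t (\<integral>\<^sub>1\<^sup>s w\<^sup>p\<^sup>-\<^sup>2 dw) ds\<close>. The second and third inequalities then become the midpoint and
  trapezoid forms of the Hermite--Hadamard inequality for the convex function \<open>w\<^sup>p\<^sup>-\<^sup>2\<close>, after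
  one differentiation; the first one only uses that this function decreases.
\<close>

section \<open>Scalar inequalities\<close>

text \<open>Convexity enters here without second derivatives: with \<open>x = t / m\<close>,
  multiplying \<open>ln x \<le> x - 1\<close> by \<open>s \<le> 0\<close> reverses it, and
  \<open>1 + y \<le> exp y\<close> at \<open>y = s * ln x\<close> gives the tangent line bound up to
  the factor \<open>m powr s\<close>.\<close>

lemma powr_above_tangent:
  fixes s t m :: real
  assumes "s \<le> 0" "t > 0" "m > 0"
  shows "m powr s + s * m powr (s - 1) * (t - m) \<le> t powr s"
proof -
  have "1 + s * (t / m - 1) \<le> 1 + s * ln (t / m)"
    using ln_le_minus_one[of "t / m"] assms by (intro add_left_mono mult_left_mono_neg) auto
  also have "\<dots> \<le> exp (s * ln (t / m))"
    by (rule exp_ge_add_one_self)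
  also have "\<dots> = (t / m) powr s"
    using assms by (simp add: powr_def)
  finally have "m powr s * (1 + s * (t / m - 1)) \<le> m powr s * (t / m) powr s"
    by (intro mult_left_mono) auto
  also have "\<dots> = t powr s"
    using assms by (simp flip: powr_mult)
  finally show ?thesis
    using assms by (simp add: powr_diff field_simps)
qed

text \<open>The deformed logarithm, which tends to \<open>ln t\<close> as \<open>r\<close> tends to
  0. For \<open>t > 0\<close> it is the integral of \<open>w powr (r - 1)\<close> from 1 to
  \<open>t\<close> when \<open>r \<noteq> 0\<close>.\<close>

definition tsallis_log :: "real \<Rightarrow> real \<Rightarrow> real"
  where "tsallis_log r t = (t powr r - 1) / r"

lemma tsallis_log_1 [simp]: "tsallis_log r 1 = 0"
  by (simp add: tsallis_log_def)

lemma DERIV_tsallis_log: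
  assumes "(f has_real_derivative d) (at t within X)" "f t > 0" "r \<noteq> 0"
  shows "((\<lambda>t. tsallis_log r (f t)) has_real_derivative f t powr (r - 1) * d) (at t within X)"
  unfolding tsallis_log_def using assms
  by (auto intro!: derivative_eq_intros DERIV_powr)

text \<open>The two derivatives are neighbouring powers of \<open>f t\<close>. Pulling out the
  smaller one leaves the factor \<open>f t - 1\<close>, whose sign is known on the relevant
  range.\<close>

lemma DERIV_tsallis_log_diff:
  assumes "(f has_real_derivative d) (at t within X)" "f t > 0" "r \<noteq> 0" "r \<noteq> 1"
  shows "((\<lambda>t. tsallis_log r (f t) - tsallis_log (r - 1) (f t)) has_real_derivative
    (f t - 1) * f t powr (r - 2) * d) (at t within X)"
proof -
  have "f t powr (r - 1) = f t * f t powr (r - 2)"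
    using assms(2) by (simp add: powr_mult_base)
  then show ?thesis
    using DERIV_diff[OF DERIV_tsallis_log[OF assms(1-3)] DERIV_tsallis_log[OF assms(1,2)], of "r - 1"]
      assms(4)
    by (simp add: algebra_simps)
qed

text \<open>Differentiating the quotient gives \<open>(t powr (r - 1) - 1) / (r - 1)\<close>, again
  a deformed logarithm. At \<open>r = 1\<close> both sides are zero through division by
  zero.\<close>

lemma DERIV_tsallis_log_quotient:
  assumes "t > 0" "r \<noteq> 0"
  shows "((\<lambda>t. (tsallis_log r t - tsallis_log 1 t) / (r - 1)) has_real_derivative
    tsallis_log (r - 1) t) (at t)"
proof -
  have "((\<lambda>t. tsallis_log r t - tsallis_log 1 t) has_real_derivative
      t powr (r - 1) * 1 - t powr (1 - 1) * 1) (at t)"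
    using assms by (intro DERIV_diff DERIV_tsallis_log DERIV_ident) auto
  from DERIV_cdivide[OF this, of "r - 1"] show ?thesis
    using assms by (simp add: tsallis_log_def)
qed

text \<open>All differences compared below vanish at 1, so a sign of the derivative to the right of
  1 decides each of them.\<close>

lemma nonneg_from_derivative:
  fixes f :: "real \<Rightarrow> real"
  assumes "f a = 0" "a \<le> t"
    and "\<And>s. a \<le> s \<Longrightarrow> (f has_real_derivative f' s) (at s)" "\<And>s. a \<le> s \<Longrightarrow> 0 \<le> f' s"
  shows "0 \<le> f t"
proof -
  have "f a \<le> f t"
    by (rule DERIV_nonneg_imp_nondecreasing[OF assms(2)]) (use assms(3,4) in blast)
  with assms(1) show ?thesis by simp
qed

section \<open>The three inequalities between deformed logarithms\<close>

context
  fixes p t :: real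
  assumes p: "p < 1" "p \<noteq> 0" and t: "1 \<le> t"
begin

text \<open>In the second formula \<open>(1 + s) / 2 - 1 = (s - 1) / 2\<close> and the inner
  derivative \<open>1 / 2\<close> together produce the factor \<open>1 / 4\<close>, which the 4 in
  the theorem cancels.\<close>

private lemma DERIV_tsallis_log_midpoint:
  assumes "1 \<le> s"
  shows "((\<lambda>t. tsallis_log p t - tsallis_log (p - 1) t) has_real_derivative
      (s - 1) * s powr (p - 2)) (at s)"
    and "((\<lambda>t. tsallis_log p ((1 + t) / 2) - tsallis_log (p - 1) ((1 + t) / 2))
      has_real_derivative (s - 1) / 4 * ((1 + s) / 2) powr (p - 2)) (at s)"
proof -
  show "((\<lambda>t. tsallis_log p t - tsallis_log (p - 1) t) has_real_derivative
      (s - 1) * s powr (p - 2)) (at s)"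
    using DERIV_tsallis_log_diff[OF DERIV_ident, of s p] assms p by simp
  have "((\<lambda>t. (1 + t) / 2) has_real_derivative 1 / 2) (at s)"
    by (auto intro!: derivative_eq_intros)
  from DERIV_tsallis_log_diff[OF this, of p]
  show "((\<lambda>t. tsallis_log p ((1 + t) / 2) - tsallis_log (p - 1) ((1 + t) / 2))
      has_real_derivative (s - 1) / 4 * ((1 + s) / 2) powr (p - 2)) (at s)"
    using assms p by (simp add: field_simps)
qed

text \<open>After differentiation and removal of \<open>s - 1\<close>, what remains is to compare
  powers with negative exponent at \<open>(1 + s) / 2 \<le> s\<close>. These decrease, and halving
  the smaller one only helps.\<close>

lemma tsallis_log_doubling_le:
  "(tsallis_log p t - tsallis_log (p - 1) t) / 2
    \<le> 4 * (tsallis_log p ((1 + t) / 2) - tsallis_log (p - 1) ((1 + t) / 2))"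
proof -
  let ?f = "\<lambda>t. 4 * (tsallis_log p ((1 + t) / 2) - tsallis_log (p - 1) ((1 + t) / 2))
    - (tsallis_log p t - tsallis_log (p - 1) t) / 2"
  have "0 \<le> ?f t"
  proof (rule nonneg_from_derivative[of _ 1, OF _ t])
    fix s :: real assume s: "1 \<le> s"
    let ?m = "(1 + s) / 2"
    show "(?f has_real_derivative (s - 1) * (?m powr (p - 2) - s powr (p - 2) / 2)) (at s)"
      by (rule DERIV_cong[OF DERIV_diff[OF DERIV_cmult[OF DERIV_tsallis_log_midpoint(2)[OF s]]
            DERIV_cdivide[OF DERIV_tsallis_log_midpoint(1)[OF s]]]])
        (simp add: right_diff_distrib)
    have "s powr (p - 2) \<le> ?m powr (p - 2)"
      using s p by (intro powr_mono2') auto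
    then have "s powr (p - 2) / 2 \<le> ?m powr (p - 2)"
      using powr_ge_zero[of s "p - 2"] by linarith
    then show "0 \<le> (s - 1) * (?m powr (p - 2) - s powr (p - 2) / 2)"
      using s by simp
  qed simp
  then show ?thesis by simp
qed

text \<open>The derivative of the difference is \<open>?g\<close>, the error of the midpoint rule
  for the integral of \<open>w powr (p - 2)\<close> over \<open>[1, s]\<close>. Its own derivative
  is the gap between this convex function and its tangent at the midpoint.\<close>

lemma tsallis_log_midpoint_le:
  "4 * (tsallis_log p ((1 + t) / 2) - tsallis_log (p - 1) ((1 + t) / 2))
    \<le> (tsallis_log p t - tsallis_log 1 t) / (p - 1)"
proof -
  let ?f = "\<lambda>t. (tsallis_log p t - tsallis_log 1 t) / (p - 1)
    - 4 * (tsallis_log p ((1 + t) / 2) - tsallis_log (p - 1) ((1 + t) / 2))"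
  let ?g = "\<lambda>t. tsallis_log (p - 1) t - (t - 1) * ((1 + t) / 2) powr (p - 2)"
  have g: "0 \<le> ?g s" if "1 \<le> s" for s
  proof (rule nonneg_from_derivative[of _ 1, OF _ that])
    fix s :: real assume s: "1 \<le> s"
    let ?m = "(1 + s) / 2"
    \<comment> \<open>Since \<open>s - ?m = (s - 1) / 2\<close>, the product rule applied to
      \<open>?g\<close> yields exactly the value at \<open>s\<close> of the tangent at
      \<open>?m\<close>.\<close>
    let ?d = "s powr (p - 2) - (?m powr (p - 2) + (p - 2) * ?m powr (p - 2 - 1) * (s - ?m))"
    show "(?g has_real_derivative ?d) (at s)"
      using s p
      by (auto intro!: derivative_eq_intros DERIV_tsallis_log simp: field_simps)
    show "0 \<le> ?d"
      using powr_above_tangent[of "p - 2" s ?m] s p by simp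
  qed simp
  have "0 \<le> ?f t"
  proof (rule nonneg_from_derivative[of _ 1, OF _ t])
    fix s :: real assume s: "1 \<le> s"
    show "(?f has_real_derivative ?g s) (at s)"
      using s p
      by (intro DERIV_cong[OF DERIV_diff[OF DERIV_tsallis_log_quotient
            DERIV_cmult[OF DERIV_tsallis_log_midpoint(2)[OF s]]]])
        auto
    show "0 \<le> ?g s" using g s by simp
  qed simp
  then show ?thesis by simp
qed

text \<open>Here \<open>?g\<close> is the error of the trapezoid rule over \<open>[1, s]\<close>;
  the quadratic term contributes the endpoint value 1 to it. The derivative of \<open>?g\<close> is
  half the gap at 1 between \<open>w powr (p - 2)\<close> and its tangent at
  \<open>s\<close>.\<close>

lemma tsallis_log_le_trapezoid:
  "(tsallis_log p t - tsallis_log 1 t) / (p - 1)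
    \<le> (tsallis_log p t - tsallis_log (p - 1) t) / 2 + (t - 1)\<^sup>2 / 4"
proof -
  let ?f = "\<lambda>t. (tsallis_log p t - tsallis_log (p - 1) t) / 2 + (t - 1)\<^sup>2 / 4
    - (tsallis_log p t - tsallis_log 1 t) / (p - 1)"
  let ?g = "\<lambda>t. (t - 1) * t powr (p - 2) / 2 + (t - 1) / 2 - tsallis_log (p - 1) t"
  have g: "0 \<le> ?g s" if "1 \<le> s" for s
  proof (rule nonneg_from_derivative[of _ 1, OF _ that])
    fix s :: real assume s: "1 \<le> s"
    let ?d = "(1 - (s powr (p - 2) + (p - 2) * s powr (p - 2 - 1) * (1 - s))) / 2"
    show "(?g has_real_derivative ?d) (at s)"
      using s p
      by (auto intro!: derivative_eq_intros DERIV_tsallis_log simp: field_simps)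
    show "0 \<le> ?d"
      using powr_above_tangent[of "p - 2" 1 s] s p by simp
  qed simp
  have "0 \<le> ?f t"
  proof (rule nonneg_from_derivative[of _ 1, OF _ t])
    fix s :: real assume s: "1 \<le> s"
    have "((\<lambda>t. (t - 1)\<^sup>2 / 4) has_real_derivative (s - 1) / 2) (at s)"
      by (auto intro!: derivative_eq_intros)
    then show "(?f has_real_derivative ?g s) (at s)"
      using s p
      by (intro DERIV_cong[OF DERIV_diff[OF DERIV_add[OF
              DERIV_cdivide[OF DERIV_tsallis_log_midpoint(1)[OF s]]]
            DERIV_tsallis_log_quotient]])
        auto
    show "0 \<le> ?g s" using g s by simp
  qed simp
  then show ?thesis by simp
qed

end

section \<open>Symmetric and coercive operators\<close>

text \<open>Polarisation expresses \<open>inner (T x) y\<close> through the quadratic form at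
  \<open>x + y\<close> and \<open>x - y\<close>; the parallelogram law adds up the bounds.\<close>

lemma symmetric_norm_le:
  fixes T :: "'a :: real_inner \<Rightarrow>\<^sub>L 'a"
  assumes sym: "\<And>x y. inner (T x) y = inner x (T y)"
    and bound: "\<And>x. \<bar>inner (T x) x\<bar> \<le> e * (norm x)\<^sup>2"
  shows "norm (T x) \<le> e * norm x"
proof (cases "x = 0 \<or> T x = 0")
  case True
  have "0 \<le> e * (norm x)\<^sup>2"
    using bound[of x] by linarith
  then have "0 \<le> e * norm x"
    by (cases "x = 0") (simp_all add: zero_le_mult_iff)
  with True show ?thesis
    by (auto simp: blinfun.zero_right)
next
  case False
  \<comment> \<open>This scaling gives \<open>y\<close> the direction of \<open>T x\<close> and the
    length of \<open>x\<close>, so the squared norms of \<open>x + y\<close> and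
    \<open>x - y\<close> add up to \<open>4 * (norm x)\<^sup>2\<close>.\<close>
  define k where "k = norm x / norm (T x)"
  define y where "y = k *\<^sub>R T x"
  have ny: "norm y = norm x"
    using False by (simp add: y_def k_def)
  have "4 * inner (T x) y = inner (T (x + y)) (x + y) - inner (T (x - y)) (x - y)"
    using sym[of y x]
    by (simp add: blinfun.add_right blinfun.diff_right inner_add_left inner_add_right
        inner_diff_left inner_diff_right inner_commute)
  also have "\<dots> \<le> e * ((norm (x + y))\<^sup>2 + (norm (x - y))\<^sup>2)"
    using bound[of "x + y"] bound[of "x - y"] by (simp add: algebra_simps abs_le_iff)
  also have "(norm (x + y))\<^sup>2 + (norm (x - y))\<^sup>2 = 4 * (norm x)\<^sup>2"
    using ny by (simp add: power2_norm_eq_inner norm_eq inner_add_left inner_add_right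
        inner_diff_left inner_diff_right)
  finally have "inner (T x) y \<le> e * (norm x)\<^sup>2"
    by simp
  moreover have "inner (T x) y = norm x * norm (T x)"
    using False by (simp add: y_def k_def dot_square_norm power2_eq_square)
  ultimately show ?thesis
    using False by (simp add: power2_eq_square mult.assoc mult.left_commute)
qed

text \<open>The form is nonnegative at \<open>x - t *\<^sub>R T x\<close>. With
  \<open>t = 1 / norm T\<close> the term quadratic in \<open>t\<close> eats up only half of the
  linear one.\<close>

lemma positive_norm_square_le:
  fixes T :: "'a :: real_inner \<Rightarrow>\<^sub>L 'a"
  assumes sym: "\<And>x y. inner (T x) y = inner x (T y)"
    and nonneg: "\<And>x. 0 \<le> inner (T x) x"
  shows "(norm (T x))\<^sup>2 \<le> norm T * inner (T x) x"
proof (cases "norm T = 0")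
  case True
  then show ?thesis by simp
next
  case False
  define t where "t = 1 / norm T"
  have "inner (T (T x)) (T x) \<le> norm (T (T x)) * norm (T x)"
    by (rule norm_cauchy_schwarz)
  also have "\<dots> \<le> norm T * norm (T x) * norm (T x)"
    by (intro mult_right_mono norm_blinfun) simp
  finally have "t\<^sup>2 * inner (T (T x)) (T x) \<le> t\<^sup>2 * (norm T * (norm (T x))\<^sup>2)"
    by (intro mult_left_mono) (simp_all add: power2_eq_square mult.assoc)
  then have *: "t\<^sup>2 * inner (T (T x)) (T x) \<le> t * (norm (T x))\<^sup>2"
    using False by (simp add: t_def power2_eq_square)
  have "0 \<le> inner (T (x - t *\<^sub>R T x)) (x - t *\<^sub>R T x)"
    by (rule nonneg)
  also have "\<dots> = inner (T x) x - 2 * t * (norm (T x))\<^sup>2 + t\<^sup>2 * inner (T (T x)) (T x)"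
    using sym[of "T x" x] unfolding power2_norm_eq_inner
    by (simp add: blinfun.diff_right blinfun.scaleR_right inner_diff_left inner_diff_right
        power2_eq_square algebra_simps)
  finally have "t * (norm (T x))\<^sup>2 \<le> inner (T x) x"
    using * by linarith
  then show ?thesis
    using False by (simp add: t_def field_simps)
qed

text \<open>Lax--Milgram: \<open>x \<mapsto> x - k (T x - y)\<close> is a contraction for small \<open>k\<close>.\<close>

lemma coercive_invertible:
  fixes T :: "'a :: {real_inner, complete_space} \<Rightarrow>\<^sub>L 'a"
  assumes c: "c > 0" and coercive: "\<And>x. c * (norm x)\<^sup>2 \<le> inner (T x) x"
  shows "\<exists>C. T o\<^sub>L C = id_blinfun \<and> C o\<^sub>L T = id_blinfun"
proof -
  have below: "c * norm x \<le> norm (T x)" for x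
  proof (cases "x = 0")
    case False
    have "c * (norm x)\<^sup>2 \<le> norm (T x) * norm x"
      using coercive[of x] norm_cauchy_schwarz[of "T x" x] by linarith
    with False show ?thesis by (simp add: power2_eq_square mult.assoc[symmetric])
  qed simp
  \<comment> \<open>\<open>M\<close> dominates both \<open>norm T\<close> and \<open>c\<close>. The
    choice of \<open>k\<close> gives \<open>k\<^sup>2 * M\<^sup>2 = k * c\<close>, so the quadratic
    term costs at most half of the gain \<open>2 * k * c\<close>, and the squared contraction factor
    is \<open>1 - k * c\<close>.\<close>
  define M where "M = norm T + c"
  define k where "k = c / M\<^sup>2"
  have M: "M > 0" "c \<le> M" "norm T \<le> M"
    using c by (auto simp: M_def add_nonneg_pos)
  have k: "k > 0" using c M by (simp add: k_def)
  have contr: "(norm (x - k *\<^sub>R T x))\<^sup>2 \<le> (1 - k * c) * (norm x)\<^sup>2" for x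
  proof -
    have "norm (T x) \<le> M * norm x"
      using norm_blinfun[of T x] M(3) mult_right_mono[of "norm T" M "norm x"] by simp
    then have "(norm (T x))\<^sup>2 \<le> (M * norm x)\<^sup>2"
      by (intro power_mono) auto
    then have "k\<^sup>2 * (norm (T x))\<^sup>2 \<le> k\<^sup>2 * (M * norm x)\<^sup>2"
      by (intro mult_left_mono) auto
    also have "\<dots> = k * (c * (norm x)\<^sup>2)"
      using M c by (simp add: k_def power2_eq_square)
    finally have 1: "k\<^sup>2 * (norm (T x))\<^sup>2 \<le> k * (c * (norm x)\<^sup>2)" .
    have 2: "k * (c * (norm x)\<^sup>2) \<le> k * inner (T x) x"
      using coercive k by (intro mult_left_mono) auto
    have 3: "(norm (x - k *\<^sub>R T x))\<^sup>2 =
        (norm x)\<^sup>2 - 2 * (k * inner (T x) x) + k\<^sup>2 * (norm (T x))\<^sup>2"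
      unfolding power2_norm_eq_inner
      by (simp add: inner_diff_left inner_diff_right inner_commute power2_eq_square algebra_simps)
    show ?thesis
      unfolding left_diff_distrib mult.assoc using 1 2 3 by linarith
  qed
  have "k * c = (c / M)\<^sup>2"
    by (simp add: k_def power2_eq_square)
  moreover have "(c / M)\<^sup>2 \<le> 1"
    using c M by (intro power_le_one) auto
  ultimately have kc: "0 \<le> 1 - k * c" "1 - k * c < 1"
    using k c by auto
  define L where "L = sqrt (1 - k * c)"
  have L: "0 \<le> L" "L < 1" using kc by (auto simp: L_def)
  have contr': "norm (x - k *\<^sub>R T x) \<le> L * norm x" for x
    using real_sqrt_le_mono[OF contr[of x]] by (simp add: L_def real_sqrt_mult)
  have "\<exists>x. T x = y" for y
  proof -
    define g where "g x = x - k *\<^sub>R (T x - y)" for x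
    have "dist (g x) (g z) \<le> L * dist x z" for x z
    proof -
      have "g x - g z = (x - z) - k *\<^sub>R T (x - z)"
        by (simp add: g_def blinfun.diff_right algebra_simps)
      then show ?thesis using contr'[of "x - z"] by (simp add: dist_norm)
    qed
    then have "\<exists>!x. g x = x"
      using banach_fix_type[OF L] by blast
    then obtain x where "g x = x" by blast
    then show ?thesis using k by (auto simp: g_def)
  qed
  then obtain C where C: "\<And>y. T (C y) = y" by metis
  \<comment> \<open>Injectivity turns the pointwise chosen preimages \<open>C\<close> into a linear
    map: \<open>T\<close> sends both sides of each linearity equation to the same vector.\<close>
  have inj: "x = z" if "T x = T z" for x z
    using below[of "x - z"] that c by (simp add: blinfun.diff_right mult_le_0_iff)
  have "bounded_linear C"
  proof (rule bounded_linear_intro[where K = "1 / c"])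
    show "C (x + y) = C x + C y" for x y
      by (rule inj) (simp add: C blinfun.add_right)
    show "C (r *\<^sub>R x) = r *\<^sub>R C x" for r x
      by (rule inj) (simp add: C blinfun.scaleR_right)
    show "norm (C x) \<le> norm x * (1 / c)" for x
      using below[of "C x"] c by (simp add: C field_simps)
  qed
  moreover have "C (T x) = x" for x
    by (rule inj) (simp add: C)
  ultimately have "T o\<^sub>L Blinfun C = id_blinfun \<and> Blinfun C o\<^sub>L T = id_blinfun"
    by (simp add: blinfun_eqI bounded_linear_Blinfun_apply C)
  then show ?thesis by blast
qed

text \<open>A left inverse bounds \<open>norm x\<close> by \<open>norm (T x)\<close>, and for a
  positive \<open>T\<close> the square of the latter is bounded by the quadratic form.\<close>

lemma positive_invertible_coercive:
  fixes T :: "'a :: real_inner \<Rightarrow>\<^sub>L 'a"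
  assumes sym: "\<And>x y. inner (T x) y = inner x (T y)"
    and nonneg: "\<And>x. 0 \<le> inner (T x) x"
    and inv: "C o\<^sub>L T = id_blinfun"
  shows "\<exists>a>0. \<forall>x. a * (norm x)\<^sup>2 \<le> inner (T x) x"
proof -
  \<comment> \<open>The summand 1 keeps \<open>K\<close> positive even on the zero space, where both
    norms vanish.\<close>
  define K where "K = (norm C)\<^sup>2 * norm T + 1"
  have K: "K > 0" by (simp add: K_def add_nonneg_pos)
  have "(norm x)\<^sup>2 \<le> K * inner (T x) x" for x
  proof -
    have "x = C (T x)"
      using arg_cong[OF inv, of "\<lambda>U. blinfun_apply U x"] by simp
    then have "norm x \<le> norm C * norm (T x)"
      by (metis norm_blinfun)
    then have "(norm x)\<^sup>2 \<le> (norm C * norm (T x))\<^sup>2"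
      by (intro power_mono) auto
    also have "\<dots> \<le> (norm C)\<^sup>2 * (norm T * inner (T x) x)"
      unfolding power_mult_distrib
      by (intro mult_left_mono positive_norm_square_le sym nonneg) auto
    finally show ?thesis
      using nonneg[of x] by (simp add: K_def algebra_simps)
  qed
  then show ?thesis
    using K by (intro exI[of _ "1 / K"]) (auto simp: field_simps)
qed

section \<open>Self-adjoint operators and their spectrum\<close>

text \<open>This makes the operator space complete, so that norm-Cauchy sequences of polynomials in
  an operator have limits.\<close>

instance complex_hilbert_space \<subseteq> banach ..

lemmas compose_tendsto = bounded_bilinear.tendsto[OF bounded_bilinear_blinfun_compose]

lemma blinfun_eq_iff: "A = B \<longleftrightarrow> (\<forall>x. blinfun_apply A x = blinfun_apply B x)"
  by (auto intro: blinfun_eqI)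

text \<open>As an equality of compositions, complex linearity passes to norm limits.\<close>

lemma bounded_operators_iff_commute:
  "A \<in> bounded_operators \<longleftrightarrow> (\<forall>c. A o\<^sub>L scalar_op c = scalar_op c o\<^sub>L A)"
  by (auto simp: bounded_operators_def blinfun_eq_iff scalar_op.rep_eq)

lemma scalar_op_of_real: "scalar_op (complex_of_real t) = t *\<^sub>R id_blinfun"
  by (rule blinfun_eqI) (simp add: scalar_op.rep_eq scaleC_of_real blinfun.scaleR_left)

lemma scaleC_scaleR: "c *\<^sub>C r *\<^sub>R x = r *\<^sub>R c *\<^sub>C x"
  for x :: "'a :: complex_hilbert_space"
  by (simp add: scaleC_of_real[symmetric] scaleC_scaleC mult.commute)

lemma scaleC_diff_right: "c *\<^sub>C (x - y) = c *\<^sub>C x - c *\<^sub>C y"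
  for x :: "'a :: complex_hilbert_space"
  using scaleC_add_right[of c "x - y" y] by (simp add: algebra_simps)

text \<open>The imaginary part of \<open>cinner x y\<close> is the real part after multiplying
  \<open>x\<close> by \<open>- \<i>\<close>, and a complex-linear \<open>A\<close> commutes with
  that factor. Later estimates can thus use the real inner product.\<close>

lemma selfadjoint_op_iff_inner:
  "selfadjoint_op A \<longleftrightarrow> A \<in> bounded_operators \<and> (\<forall>x y. inner (A x) y = inner x (A y))"
proof (intro iffI conjI)
  assume *: "A \<in> bounded_operators \<and> (\<forall>x y. inner (A x) y = inner x (A y))"
  have im: "Im (cinner x y) = inner ((- \<i>) *\<^sub>C x) y" for x y :: 'a
    by (simp add: inner_eq_Re_cinner cinner_scaleC_left)
  have "Im (cinner (A x) y) = Im (cinner x (A y))" for x y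
    using * unfolding im by (metis (mono_tags, lifting) bounded_operators_def mem_Collect_eq)
  moreover have "Re (cinner (A x) y) = Re (cinner x (A y))" for x y
    using * by (simp add: inner_eq_Re_cinner)
  ultimately show "selfadjoint_op A"
    using * by (simp add: selfadjoint_op_def complex_eq_iff)
qed (auto simp: selfadjoint_op_def inner_eq_Re_cinner)

lemma selfadjoint_opD:
  assumes "selfadjoint_op A"
  shows "A \<in> bounded_operators" "inner (A x) y = inner x (A y)"
  using assms by (auto simp: selfadjoint_op_iff_inner)

lemma positive_op_iff_inner:
  "positive_op A \<longleftrightarrow> selfadjoint_op A \<and> (\<forall>x. 0 \<le> inner (A x) x)"
  by (simp add: positive_op_def inner_eq_Re_cinner)

lemma selfadjoint_op_id: "selfadjoint_op id_blinfun"
  by (simp add: selfadjoint_op_iff_inner bounded_operators_def)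

lemma selfadjoint_op_zero: "selfadjoint_op 0"
  by (simp add: selfadjoint_op_iff_inner bounded_operators_iff_commute)

lemma selfadjoint_op_add: "selfadjoint_op A \<Longrightarrow> selfadjoint_op B \<Longrightarrow> selfadjoint_op (A + B)"
  by (simp add: selfadjoint_op_iff_inner bounded_operators_def blinfun.add_left
      scaleC_add_right inner_add_left inner_add_right)

lemma selfadjoint_op_scaleR: "selfadjoint_op A \<Longrightarrow> selfadjoint_op (r *\<^sub>R A)"
  by (simp add: selfadjoint_op_iff_inner bounded_operators_def blinfun.scaleR_left scaleC_scaleR)

lemma selfadjoint_op_diff: "selfadjoint_op A \<Longrightarrow> selfadjoint_op B \<Longrightarrow> selfadjoint_op (A - B)"
  by (simp add: selfadjoint_op_iff_inner bounded_operators_def blinfun.diff_left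
      scaleC_diff_right inner_diff_left inner_diff_right)

lemma selfadjoint_op_compose_commute:
  assumes "selfadjoint_op A" "selfadjoint_op B" "A o\<^sub>L B = B o\<^sub>L A"
  shows "selfadjoint_op (A o\<^sub>L B)"
proof -
  have "A (B y) = B (A y)" for y
    using arg_cong[OF assms(3), of "\<lambda>T. blinfun_apply T y"] by simp
  then show ?thesis
    using assms(1,2) by (auto simp: selfadjoint_op_iff_inner bounded_operators_def)
qed

lemma selfadjoint_op_sandwich:
  assumes "selfadjoint_op R" "selfadjoint_op X"
  shows "selfadjoint_op (R o\<^sub>L X o\<^sub>L R)"
  using assms by (auto simp: selfadjoint_op_iff_inner bounded_operators_def)

lemma selfadjoint_op_tendsto:
  assumes "X \<longlonglongrightarrow> T" "\<And>n. selfadjoint_op (X n)"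
  shows "selfadjoint_op T"
  unfolding selfadjoint_op_iff_inner bounded_operators_iff_commute
proof (intro conjI allI)
  fix c
  have "(\<lambda>n. X n o\<^sub>L scalar_op c) \<longlonglongrightarrow> (T o\<^sub>L scalar_op c)"
    and "(\<lambda>n. scalar_op c o\<^sub>L X n) \<longlonglongrightarrow> (scalar_op c o\<^sub>L T)"
    by (intro compose_tendsto tendsto_const assms)+
  moreover have "X n o\<^sub>L scalar_op c = scalar_op c o\<^sub>L X n" for n
    using assms(2) by (auto simp: selfadjoint_op_iff_inner bounded_operators_iff_commute)
  ultimately show "T o\<^sub>L scalar_op c = scalar_op c o\<^sub>L T"
    using LIMSEQ_unique by auto
next
  fix x y
  have "(\<lambda>n. inner (X n x) y) \<longlonglongrightarrow> inner (T x) y"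
    and "(\<lambda>n. inner x (X n y)) \<longlonglongrightarrow> inner x (T y)"
    by (intro tendsto_inner tendsto_const blinfun.tendsto assms)+
  moreover have "inner (X n x) y = inner x (X n y)" for n
    using assms(2) by (simp add: selfadjoint_opD)
  ultimately show "inner (T x) y = inner x (T y)"
    using LIMSEQ_unique by auto
qed

text \<open>The inverse from the contraction argument is only real-linear by construction; complex
  linearity is inherited from \<open>A\<close>.\<close>

lemma invertible_opI:
  assumes A: "A \<in> bounded_operators" and C: "A o\<^sub>L C = id_blinfun" "C o\<^sub>L A = id_blinfun"
  shows "invertible_op A"
proof -
  have AC: "A (C x) = x" and CA: "C (A x) = x" for x
    using arg_cong[OF C(1), of "\<lambda>T. blinfun_apply T x"]
      arg_cong[OF C(2), of "\<lambda>T. blinfun_apply T x"] by simp_all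
  have "C (c *\<^sub>C x) = c *\<^sub>C C x" for c x
  proof -
    have "C (c *\<^sub>C x) = C (A (c *\<^sub>C C x))"
      using A by (simp add: bounded_operators_def AC)
    then show ?thesis by (simp add: CA)
  qed
  then have "C \<in> bounded_operators"
    by (simp add: bounded_operators_def)
  with C show ?thesis
    unfolding invertible_op_def by blast
qed

lemma invertible_op_compose:
  assumes "invertible_op A" "invertible_op B"
  shows "invertible_op (A o\<^sub>L B)"
proof -
  obtain C D where CD: "C \<in> bounded_operators" "D \<in> bounded_operators"
    "A o\<^sub>L C = id_blinfun" "C o\<^sub>L A = id_blinfun" "B o\<^sub>L D = id_blinfun" "D o\<^sub>L B = id_blinfun"
    using assms unfolding invertible_op_def by blast
  have "D o\<^sub>L C \<in> bounded_operators"
    using CD(1,2) by (simp add: bounded_operators_def)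
  moreover have "A o\<^sub>L B o\<^sub>L (D o\<^sub>L C) = id_blinfun" "D o\<^sub>L C o\<^sub>L (A o\<^sub>L B) = id_blinfun"
    using CD(3-6) by (simp_all add: blinfun_eq_iff)
  ultimately show ?thesis
    unfolding invertible_op_def by blast
qed

lemma invertible_op_scaleR:
  assumes "invertible_op A" "r \<noteq> 0"
  shows "invertible_op (r *\<^sub>R A)"
proof -
  obtain C where C: "C \<in> bounded_operators" "A o\<^sub>L C = id_blinfun" "C o\<^sub>L A = id_blinfun"
    using assms(1) unfolding invertible_op_def by blast
  have "(1 / r) *\<^sub>R C \<in> bounded_operators"
    using C(1) by (simp add: bounded_operators_def blinfun.scaleR_left scaleC_scaleR)
  moreover have "r *\<^sub>R A o\<^sub>L (1 / r) *\<^sub>R C = id_blinfun" "(1 / r) *\<^sub>R C o\<^sub>L r *\<^sub>R A = id_blinfun"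
    using C(2,3) assms(2) by (auto simp: blinfun_eq_iff blinfun.scaleR_left blinfun.scaleR_right)
  ultimately show ?thesis
    unfolding invertible_op_def by blast
qed

section \<open>Quadratic form bounds and the real spectrum\<close>

abbreviation real_spectrum :: "('a :: complex_hilbert_space \<Rightarrow>\<^sub>L 'a) \<Rightarrow> real set"
  where "real_spectrum A \<equiv> {t. complex_of_real t \<in> op_spectrum A}"

lemma real_spectrum_iff: "t \<in> real_spectrum A \<longleftrightarrow> \<not> invertible_op (A - t *\<^sub>R id_blinfun)"
  by (simp add: op_spectrum_def scalar_op_of_real)

lemma coercive_invertible_op:
  assumes "A \<in> bounded_operators" "c > 0" "\<And>x. c * (norm x)\<^sup>2 \<le> inner (A x) x"
  shows "invertible_op A"
  using coercive_invertible[OF assms(2,3)] invertible_opI[OF assms(1)] by blast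

text \<open>For \<open>t < m\<close> the operator \<open>A - t\<close> is coercive with constant
  \<open>m - t\<close>, hence invertible.\<close>

lemma real_spectrum_ge:
  assumes A: "selfadjoint_op A" and m: "\<And>x. m * (norm x)\<^sup>2 \<le> inner (A x) x"
    and t: "t \<in> real_spectrum A"
  shows "m \<le> t"
proof (rule ccontr)
  assume "\<not> m \<le> t"
  then have "invertible_op (A - t *\<^sub>R id_blinfun)"
    using m
    by (intro coercive_invertible_op[of _ "m - t"] selfadjoint_opD(1)
        selfadjoint_op_diff selfadjoint_op_scaleR selfadjoint_op_id A)
      (auto simp: blinfun.diff_left blinfun.scaleR_left inner_diff_left dot_square_norm algebra_simps)
  with t show False unfolding real_spectrum_iff by simp
qed

lemma inner_apply_bound: "\<bar>inner (A x) x\<bar> \<le> norm A * (norm x)\<^sup>2"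
  for A :: "'a :: real_inner \<Rightarrow>\<^sub>L 'a"
proof -
  have "\<bar>inner (A x) x\<bar> \<le> norm (A x) * norm x"
    by (rule Cauchy_Schwarz_ineq2)
  also have "\<dots> \<le> norm A * norm x * norm x"
    by (intro mult_right_mono norm_blinfun) auto
  finally show ?thesis by (simp add: power2_eq_square mult.assoc)
qed

lemma real_spectrum_le_norm:
  assumes A: "selfadjoint_op A" and t: "t \<in> real_spectrum A"
  shows "t \<le> norm A"
proof (rule ccontr)
  assume nt: "\<not> t \<le> norm A"
  have *: "(t - norm A) * (norm x)\<^sup>2 \<le> inner ((t *\<^sub>R id_blinfun - A) x) x" for x
    using inner_apply_bound[of A x]
    by (auto simp: blinfun.diff_left blinfun.scaleR_left inner_diff_left dot_square_norm
        algebra_simps abs_le_iff)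
  have "invertible_op (t *\<^sub>R id_blinfun - A)"
    using nt
    by (intro coercive_invertible_op[OF _ _ *] selfadjoint_opD(1)
        selfadjoint_op_diff selfadjoint_op_scaleR selfadjoint_op_id A) auto
  from invertible_op_scaleR[OF this, of "- 1"]
  have "invertible_op (A - t *\<^sub>R id_blinfun)" by simp
  with t show False unfolding real_spectrum_iff by simp
qed

text \<open>
  The largest lower bound \<open>m\<close> of the quadratic form lies in the spectrum: were \<open>A - m\<close>
  invertible, it would be coercive, and the bound could be improved.
\<close>

lemma real_spectrum_lower_bound:
  assumes A: "selfadjoint_op A" and m: "\<And>t. t \<in> real_spectrum A \<Longrightarrow> m \<le> t"
  shows "m * (norm x)\<^sup>2 \<le> inner (A x) x"
proof (rule ccontr)
  assume neg: "\<not> m * (norm x)\<^sup>2 \<le> inner (A x) x"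
  then have x: "x \<noteq> 0" by auto
  define L where "L = {l. \<forall>x. l * (norm x)\<^sup>2 \<le> inner (A x) x}"
  \<comment> \<open>Rayleigh quotients bound \<open>L\<close> above because the nonzero vector
    \<open>x\<close> exists; with \<open>- norm A\<close> in \<open>L\<close>, the supremum is
    meaningful.\<close>
  have L_le: "l \<le> inner (A y) y / (norm y)\<^sup>2" if "l \<in> L" "y \<noteq> 0" for l y
    using that by (auto simp: L_def field_simps)
  have ne: "- norm A \<in> L"
    using inner_apply_bound[of A] by (auto simp: L_def abs_le_iff minus_le_iff)
  have bdd: "bdd_above L"
    using L_le x by (intro bdd_aboveI) auto
  define s where "s = Sup L"
  have s_L: "s \<in> L"
  proof -
    have "s * (norm y)\<^sup>2 \<le> inner (A y) y" for y
    proof (cases "y = 0")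
      case False
      have "s \<le> inner (A y) y / (norm y)\<^sup>2"
        unfolding s_def using ne L_le[OF _ False] by (intro cSup_least) auto
      with False show ?thesis by (simp add: field_simps)
    qed simp
    then show ?thesis by (simp add: L_def)
  qed
  have "s < m"
  proof (rule ccontr)
    assume "\<not> s < m"
    then have "m * (norm x)\<^sup>2 \<le> s * (norm x)\<^sup>2"
      by (intro mult_right_mono) auto
    also have "\<dots> \<le> inner (A x) x"
      using s_L by (simp add: L_def)
    finally show False using neg by simp
  qed
  let ?D = "A - s *\<^sub>R id_blinfun"
  have D: "selfadjoint_op ?D"
    by (intro selfadjoint_op_diff selfadjoint_op_scaleR selfadjoint_op_id A)
  have "invertible_op ?D"
    using m[of s] \<open>s < m\<close> real_spectrum_iff[of s A] by auto
  then obtain C where C: "C o\<^sub>L ?D = id_blinfun"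
    unfolding invertible_op_def by blast
  have "0 \<le> inner (?D x) x" for x
    using s_L by (simp add: L_def blinfun.diff_left blinfun.scaleR_left inner_diff_left dot_square_norm)
  then obtain a where a: "a > 0" "\<And>x. a * (norm x)\<^sup>2 \<le> inner (?D x) x"
    using positive_invertible_coercive[OF selfadjoint_opD(2)[OF D] _ C] by blast
  have "s + a \<in> L"
    unfolding L_def
  proof (intro CollectI allI)
    fix y
    show "(s + a) * (norm y)\<^sup>2 \<le> inner (A y) y"
      using a(2)[of y]
      by (simp add: blinfun.diff_left blinfun.scaleR_left inner_diff_left dot_square_norm algebra_simps)
  qed
  from cSup_upper[OF this bdd] a(1) show False
    by (simp add: s_def)
qed

section \<open>Polynomials in an operator\<close>

lemma op_poly_eq_sum:
  assumes "degree q \<le> n"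
  shows "op_poly q A = (\<Sum>i\<le>n. coeff q i *\<^sub>R ((\<lambda>T. A o\<^sub>L T) ^^ i) id_blinfun)"
  unfolding op_poly_def using assms
  by (intro sum.mono_neutral_left) (auto simp: coeff_eq_0)

lemma op_poly_pCons: "op_poly (pCons a q) A = a *\<^sub>R id_blinfun + (A o\<^sub>L op_poly q A)"
proof -
  have "op_poly (pCons a q) A =
      (\<Sum>i\<le>Suc (degree q). coeff (pCons a q) i *\<^sub>R ((\<lambda>T. A o\<^sub>L T) ^^ i) id_blinfun)"
    by (intro op_poly_eq_sum degree_pCons_le)
  also have "\<dots> = a *\<^sub>R id_blinfun +
      (\<Sum>i\<le>degree q. coeff q i *\<^sub>R (A o\<^sub>L ((\<lambda>T. A o\<^sub>L T) ^^ i) id_blinfun))"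
    by (subst sum.atMost_Suc_shift) simp
  also have "(\<Sum>i\<le>degree q. coeff q i *\<^sub>R (A o\<^sub>L ((\<lambda>T. A o\<^sub>L T) ^^ i) id_blinfun)) =
      A o\<^sub>L op_poly q A"
    by (rule blinfun_eqI)
      (simp add: op_poly_def blinfun.sum_left blinfun.sum_right blinfun.scaleR_left
        blinfun.scaleR_right)
  finally show ?thesis .
qed

lemma op_poly_0: "op_poly 0 A = 0"
  by (simp add: op_poly_def)

lemma op_poly_const: "op_poly [:c:] A = c *\<^sub>R id_blinfun"
  by (simp add: op_poly_pCons op_poly_0)

lemma op_poly_add: "op_poly (p + q) A = op_poly p A + op_poly q A"
  by (induction p q rule: poly_induct2)
    (auto simp: op_poly_pCons op_poly_0 blinfun_eq_iff blinfun.bilinear_simps scaleR_add_left)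

lemma op_poly_smult: "op_poly (smult c p) A = c *\<^sub>R op_poly p A"
  by (induction p) (auto simp: op_poly_pCons op_poly_0 blinfun_eq_iff blinfun.bilinear_simps
      scaleR_add_right)

lemma op_poly_diff: "op_poly (p - q) A = op_poly p A - op_poly q A"
  using op_poly_add[of "p - q" q A] by simp

lemma op_poly_mult: "op_poly (p * q) A = op_poly p A o\<^sub>L op_poly q A"
  by (induction p) (auto simp: op_poly_pCons op_poly_0 op_poly_add op_poly_smult blinfun_eq_iff
      blinfun.bilinear_simps)

lemma op_poly_pcompose_affine:
  "op_poly (pcompose q [:b, a:]) A = op_poly q (a *\<^sub>R A + b *\<^sub>R id_blinfun)"
  by (induction q) (auto simp: pcompose_pCons op_poly_pCons op_poly_0 op_poly_add op_poly_mult
      op_poly_smult blinfun_eq_iff blinfun.bilinear_simps add_ac)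

lemma selfadjoint_op_poly:
  assumes A: "selfadjoint_op A"
  shows "selfadjoint_op (op_poly q A)"
proof (induction q)
  case 0
  show ?case by (simp add: op_poly_0 selfadjoint_op_zero)
next
  case (pCons a q)
  \<comment> \<open>Reading the product of \<open>q\<close> with the variable in both orders shows
    that \<open>A\<close> commutes with \<open>op_poly q A\<close>, as self-adjointness of the
    product requires.\<close>
  have "op_poly (pCons 0 q) A = op_poly (q * [:0, 1:]) A"
    by simp
  then have "A o\<^sub>L op_poly q A = op_poly q A o\<^sub>L A"
    unfolding op_poly_mult op_poly_pCons op_poly_0 by (simp add: blinfun_eq_iff)
  then show ?case
    unfolding op_poly_pCons
    by (intro selfadjoint_op_add selfadjoint_op_scaleR selfadjoint_op_id
        selfadjoint_op_compose_commute A pCons.IH)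
qed

section \<open>Functional calculus\<close>

lemma poly_map_of_real_mult:
  "poly (map_poly complex_of_real (p * q)) z =
    poly (map_poly complex_of_real p) z * poly (map_poly complex_of_real q) z"
proof -
  have "map_poly complex_of_real (p * q) = map_poly of_real p * map_poly of_real q"
    by (rule poly_eqI) (simp add: coeff_map_poly coeff_mult)
  then show ?thesis by simp
qed

lemma poly_map_of_real_add:
  "poly (map_poly complex_of_real (p + q)) z =
    poly (map_poly complex_of_real p) z + poly (map_poly complex_of_real q) z"
proof -
  have "map_poly complex_of_real (p + q) = map_poly of_real p + map_poly of_real q"
    by (rule poly_eqI) (simp add: coeff_map_poly)
  then show ?thesis by simp
qed

text \<open>A complex root \<open>a + b * \<i>\<close> exists. It splits off a linear factor if
  \<open>b = 0\<close>, and otherwise the quadratic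
  \<open>(x - a)\<^sup>2 + b\<^sup>2\<close>.\<close>

lemma real_poly_factor:
  fixes r :: "real poly"
  assumes "degree r > 0"
  obtains t s where "r = [:- t, 1:] * s"
    | a b s where "b \<noteq> 0" "r = [:a\<^sup>2 + b\<^sup>2, - 2 * a, 1:] * s"
proof -
  let ?c = "map_poly complex_of_real"
  have "\<not> constant (poly (?c r))"
    using assms by (simp add: constant_degree degree_map_poly)
  then obtain z where z: "poly (?c r) z = 0"
    using fundamental_theorem_of_algebra by blast
  define a b where "a = Re z" and "b = Im z"
  have z_eq: "z = Complex a b"
    by (simp add: a_def b_def)
  show thesis
  proof (cases "b = 0")
    case True
    then have "z = of_real a"
      by (simp add: z_eq complex_of_real_def)
    moreover have "poly (?c r) (of_real a) = of_real (poly r a)"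
      by (induction r) (auto simp: map_poly_pCons)
    ultimately have "poly r a = 0"
      using z by simp
    then show ?thesis
      using that(1) by (auto simp: poly_eq_0_iff_dvd elim!: dvdE)
  next
    case False
    let ?d = "[:a\<^sup>2 + b\<^sup>2, - 2 * a, 1:]"
    \<comment> \<open>The remainder is real, of degree at most 1, and vanishes at a nonreal number,
      so it is zero.\<close>
    define m where "m = r mod ?d"
    have r: "?d * (r div ?d) + m = r"
      unfolding m_def by (rule mult_div_mod_eq)
    have "degree m < 2"
      using degree_mod_less[of ?d r] by (auto simp: m_def)
    then have "m = [:coeff m 0, coeff m 1:]"
      by (intro poly_eqI) (auto simp: coeff_pCons coeff_eq_0 split: nat.splits)
    then obtain c d where m: "m = [:c, d:]" by blast
    have "poly (?c ?d) z = 0"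
      by (simp add: z_eq map_poly_pCons complex_eq_iff power2_eq_square algebra_simps)
    moreover have "poly (?c (?d * (r div ?d) + m)) z = 0"
      unfolding r by (rule z)
    ultimately have "poly (?c m) z = 0"
      unfolding poly_map_of_real_add poly_map_of_real_mult by simp
    then have "c + d * a = 0" "d * b = 0"
      by (simp_all add: m z_eq map_poly_pCons complex_eq_iff mult.commute)
    then have "m = 0"
      using False by (simp add: m)
    then show ?thesis
      using that(2)[OF False, of a "r div ?d"] r by simp
  qed
qed

text \<open>Induction over the factors: a linear one is invertible because its root lies outside the
  spectrum, and a quadratic one, \<open>(A - a)\<^sup>2 + b\<^sup>2\<close>, is coercive with
  constant \<open>b\<^sup>2\<close>.\<close>

lemma invertible_op_poly:
  assumes A: "selfadjoint_op A"
  shows "r \<noteq> 0 \<Longrightarrow> (\<And>t. t \<in> real_spectrum A \<Longrightarrow> poly r t \<noteq> 0) \<Longrightarrow> invertible_op (op_poly r A)"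
proof (induction "degree r" arbitrary: r rule: less_induct)
  case less
  show ?case
  proof (cases "degree r = 0")
    case True
    then obtain c where c: "r = [:c:]"
      by (rule degree_eq_zeroE)
    have "invertible_op (id_blinfun :: 'a \<Rightarrow>\<^sub>L 'a)"
      by (rule invertible_opI[of _ id_blinfun])
        (auto simp: selfadjoint_opD selfadjoint_op_id blinfun_eq_iff)
    then show ?thesis
      using less.prems(1) by (simp add: c op_poly_const invertible_op_scaleR)
  next
    case False
    then have "degree r > 0" by simp
    then show ?thesis
    proof (cases rule: real_poly_factor)
      case (1 t s)
      have s: "s \<noteq> 0" using 1 less.prems(1) by auto
      have "degree s < degree r"
        using s unfolding 1 by (subst degree_mult_eq) auto
      then have "invertible_op (op_poly s A)"
        using less.prems(2) by (intro less.hyps s) (auto simp: 1)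
      moreover have "op_poly [:- t, 1:] A = A - t *\<^sub>R id_blinfun"
        by (simp add: op_poly_pCons op_poly_0 blinfun_eq_iff blinfun.bilinear_simps)
      moreover have "invertible_op (A - t *\<^sub>R id_blinfun)"
        using less.prems(2)[of t] real_spectrum_iff[of t A] by (auto simp: 1)
      ultimately show ?thesis
        unfolding 1 op_poly_mult by (simp add: invertible_op_compose)
    next
      case (2 a b s)
      let ?d = "[:a\<^sup>2 + b\<^sup>2, - 2 * a, 1:]"
      have s: "s \<noteq> 0" using 2 less.prems(1) by auto
      have deg: "degree s < degree r"
        using s unfolding 2 by (subst degree_mult_eq) auto
      have "poly s t \<noteq> 0" if "t \<in> real_spectrum A" for t
        using less.prems(2)[OF that] by (auto simp: 2)
      then have "invertible_op (op_poly s A)"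
        by (rule less.hyps[OF deg s])
      moreover have "invertible_op (op_poly ?d A)"
      proof (rule coercive_invertible_op)
        show "op_poly ?d A \<in> bounded_operators"
          by (intro selfadjoint_opD selfadjoint_op_poly A)
        show "b\<^sup>2 > 0" using 2 by simp
        fix x
        have "inner (op_poly ?d A x) x =
            inner (A x - a *\<^sub>R x) (A x - a *\<^sub>R x) + b\<^sup>2 * (norm x)\<^sup>2"
          using selfadjoint_opD(2)[OF A, of "A x" x] unfolding power2_norm_eq_inner
          by (simp add: op_poly_pCons op_poly_0 blinfun.bilinear_simps inner_add_left
              inner_add_right inner_diff_left inner_diff_right inner_commute power2_eq_square
              algebra_simps)
        then show "b\<^sup>2 * (norm x)\<^sup>2 \<le> inner (op_poly ?d A x) x"
          by simp
      qed
      ultimately show ?thesis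
        unfolding 2 op_poly_mult by (simp add: invertible_op_compose)
    qed
  qed
qed

text \<open>Half of the spectral mapping theorem: for \<open>l < m\<close> the polynomial
  \<open>q - [:l:]\<close> has no zero on the spectrum of \<open>A\<close>, so \<open>l\<close> is
  not in the spectrum of \<open>op_poly q A\<close>.\<close>

lemma op_poly_lower_bound:
  assumes A: "selfadjoint_op A" and q: "\<And>t. t \<in> real_spectrum A \<Longrightarrow> m \<le> poly q t"
  shows "m * (norm x)\<^sup>2 \<le> inner (op_poly q A x) x"
proof (cases "real_spectrum A = {}")
  case True
  \<comment> \<open>With empty spectrum every real is a lower bound of the form. One beyond
    \<open>norm A\<close> forces \<open>x = 0\<close>.\<close>
  have "(norm A + 1) * (norm x)\<^sup>2 \<le> inner (A x) x"
    using True by (intro real_spectrum_lower_bound[OF A]) auto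
  also have "\<dots> \<le> norm A * (norm x)\<^sup>2"
    using inner_apply_bound[of A x] by linarith
  finally have "x = 0" by (simp add: algebra_simps)
  then show ?thesis by simp
next
  case False
  show ?thesis
  proof (rule real_spectrum_lower_bound[OF selfadjoint_op_poly[OF A]], rule ccontr)
    fix l assume l: "l \<in> real_spectrum (op_poly q A)" and "\<not> m \<le> l"
    then have ne: "poly (q - [:l:]) t \<noteq> 0" if "t \<in> real_spectrum A" for t
      using q[OF that] by simp
    then have "q - [:l:] \<noteq> 0"
      using False by (metis all_not_in_conv poly_0)
    from invertible_op_poly[OF A this ne] have "invertible_op (op_poly q A - l *\<^sub>R id_blinfun)"
      by (simp add: op_poly_diff op_poly_const)
    with l show False unfolding real_spectrum_iff by simp
  qed
qed

lemma norm_op_poly_le: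
  assumes A: "selfadjoint_op A" and e: "0 \<le> e"
    and q: "\<And>t. t \<in> real_spectrum A \<Longrightarrow> \<bar>poly q t\<bar> \<le> e"
  shows "norm (op_poly q A) \<le> e"
proof (rule norm_blinfun_bound[OF e], rule symmetric_norm_le)
  fix x
  have "- e * (norm x)\<^sup>2 \<le> inner (op_poly q A x) x"
    using q by (intro op_poly_lower_bound[OF A]) (auto simp: abs_le_iff minus_le_iff)
  moreover have "- e * (norm x)\<^sup>2 \<le> inner (op_poly (0 - q) A x) x"
    using q by (intro op_poly_lower_bound[OF A]) (auto simp: abs_le_iff)
  then have "inner (op_poly q A x) x \<le> e * (norm x)\<^sup>2"
    unfolding op_poly_diff op_poly_0 by (simp add: blinfun.minus_left)
  ultimately show "\<bar>inner (op_poly q A x) x\<bar> \<le> e * (norm x)\<^sup>2"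
    by simp
qed (simp add: selfadjoint_opD selfadjoint_op_poly A)

text \<open>The predicate under the description operator in \<open>fun_calc\<close>. As a relation
  it obeys algebraic rules before existence and uniqueness of the value are known.\<close>

definition has_fun_calc ::
    "('a :: complex_hilbert_space \<Rightarrow>\<^sub>L 'a) \<Rightarrow> (real \<Rightarrow> real) \<Rightarrow> ('a \<Rightarrow>\<^sub>L 'a) \<Rightarrow> bool"
  where "has_fun_calc A f T \<longleftrightarrow> (\<exists>q :: nat \<Rightarrow> real poly.
    uniform_limit (real_spectrum A) (\<lambda>n. poly (q n)) f sequentially \<and>
    (\<lambda>n. op_poly (q n) A) \<longlonglongrightarrow> T)"

lemma has_fun_calcI:
  "uniform_limit (real_spectrum A) (\<lambda>n. poly (q n)) f sequentially \<Longrightarrow>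
    (\<lambda>n. op_poly (q n) A) \<longlonglongrightarrow> T \<Longrightarrow> has_fun_calc A f T"
  unfolding has_fun_calc_def by blast

lemma has_fun_calcE:
  assumes "has_fun_calc A f T"
  obtains q where "uniform_limit (real_spectrum A) (\<lambda>n. poly (q n)) f sequentially"
    "(\<lambda>n. op_poly (q n) A) \<longlonglongrightarrow> T"
  using assms unfolding has_fun_calc_def by blast

lemma has_fun_calc_cong:
  assumes "\<And>t. t \<in> real_spectrum A \<Longrightarrow> f t = g t"
  shows "has_fun_calc A f T \<longleftrightarrow> has_fun_calc A g T"
  unfolding has_fun_calc_def
  by (intro ex_cong1 conj_cong uniform_limit_cong' refl assms)

section \<open>Algebraic rules for the functional calculus\<close>

lemma poly_fun_simps:
  "poly (p + q) = (\<lambda>t. poly p t + poly q t)"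
  "poly (p * q) = (\<lambda>t. poly p t * poly q t)"
  "poly (smult c p) = (\<lambda>t. c * poly p t)"
  by auto

lemma has_fun_calc_add:
  assumes "has_fun_calc A f S" "has_fun_calc A g T"
  shows "has_fun_calc A (\<lambda>t. f t + g t) (S + T)"
proof -
  obtain q r where
    "uniform_limit (real_spectrum A) (\<lambda>n. poly (q n)) f sequentially" "(\<lambda>n. op_poly (q n) A) \<longlonglongrightarrow> S"
    "uniform_limit (real_spectrum A) (\<lambda>n. poly (r n)) g sequentially" "(\<lambda>n. op_poly (r n) A) \<longlonglongrightarrow> T"
    using assms by (elim has_fun_calcE)
  then show ?thesis
    by (intro has_fun_calcI[where q = "\<lambda>n. q n + r n"])
      (auto simp: op_poly_add poly_fun_simps simp del: poly_add intro!: tendsto_intros uniform_limit_intros)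
qed

lemma has_fun_calc_scaleR:
  assumes "has_fun_calc A f T"
  shows "has_fun_calc A (\<lambda>t. c * f t) (c *\<^sub>R T)"
proof -
  obtain q where
    "uniform_limit (real_spectrum A) (\<lambda>n. poly (q n)) f sequentially" "(\<lambda>n. op_poly (q n) A) \<longlonglongrightarrow> T"
    using assms by (elim has_fun_calcE)
  then show ?thesis
    by (intro has_fun_calcI[where q = "\<lambda>n. smult c (q n)"])
      (auto simp: op_poly_smult poly_fun_simps simp del: poly_smult intro!: tendsto_intros
        bounded_linear.uniform_limit[OF bounded_linear_mult_right])
qed

lemma has_fun_calc_diff:
  assumes "has_fun_calc A f S" "has_fun_calc A g T"
  shows "has_fun_calc A (\<lambda>t. f t - g t) (S - T)"
  using has_fun_calc_add[OF assms(1) has_fun_calc_scaleR[OF assms(2), of "- 1"]] by simp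

text \<open>Boundedness on the spectrum is what keeps the convergence of the products
  uniform.\<close>

lemma has_fun_calc_mult:
  assumes "has_fun_calc A f S" "has_fun_calc A g T"
    and "bounded (f ` real_spectrum A)" "bounded (g ` real_spectrum A)"
  shows "has_fun_calc A (\<lambda>t. f t * g t) (S o\<^sub>L T)"
proof -
  obtain q r where
    "uniform_limit (real_spectrum A) (\<lambda>n. poly (q n)) f sequentially" "(\<lambda>n. op_poly (q n) A) \<longlonglongrightarrow> S"
    "uniform_limit (real_spectrum A) (\<lambda>n. poly (r n)) g sequentially" "(\<lambda>n. op_poly (r n) A) \<longlonglongrightarrow> T"
    using assms(1,2) by (elim has_fun_calcE)
  then show ?thesis
    using assms(3,4)
    by (intro has_fun_calcI[where q = "\<lambda>n. q n * r n"])
      (auto simp: op_poly_mult poly_fun_simps simp del: poly_mult intro!: compose_tendsto uniform_lim_mult)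
qed

lemma has_fun_calc_poly: "has_fun_calc A (poly q) (op_poly q A)"
  by (intro has_fun_calcI[where q = "\<lambda>n. q"]) (auto intro!: uniform_limit_const)

lemma has_fun_calc_const: "has_fun_calc A (\<lambda>t. c) (c *\<^sub>R id_blinfun)"
proof -
  have "poly [:c:] = (\<lambda>t. c)" by auto
  then show ?thesis
    using has_fun_calc_poly[of A "[:c:]"] by (simp add: op_poly_const)
qed

lemma has_fun_calc_ident: "has_fun_calc A (\<lambda>t. t) A"
proof -
  have "poly [:0, 1:] = (\<lambda>t :: real. t)" "op_poly [:0, 1:] A = A"
    by (auto simp: fun_eq_iff op_poly_pCons op_poly_0 blinfun_eq_iff)
  then show ?thesis
    using has_fun_calc_poly[of A "[:0, 1:]"] by simp
qed

text \<open>The map \<open>t \<mapsto> a * t + b\<close> carries the spectrum of \<open>A\<close>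
  into that of the affine image, so composing the approximating polynomials with it preserves
  uniform convergence. This brings several operators under the calculus of a single one.\<close>

lemma has_fun_calc_affine:
  assumes "has_fun_calc (a *\<^sub>R A + b *\<^sub>R id_blinfun) f T" "a \<noteq> 0"
  shows "has_fun_calc A (\<lambda>t. f (a * t + b)) T"
proof -
  let ?B = "a *\<^sub>R A + b *\<^sub>R id_blinfun"
  obtain q where q: "uniform_limit (real_spectrum ?B) (\<lambda>n. poly (q n)) f sequentially"
    "(\<lambda>n. op_poly (q n) ?B) \<longlonglongrightarrow> T"
    using assms(1) by (elim has_fun_calcE)
  have spec: "a * t + b \<in> real_spectrum ?B" if "t \<in> real_spectrum A" for t
  proof (rule ccontr)
    assume "a * t + b \<notin> real_spectrum ?B"
    then have "invertible_op (?B - (a * t + b) *\<^sub>R id_blinfun)"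
      unfolding real_spectrum_iff by simp
    also have "?B - (a * t + b) *\<^sub>R id_blinfun = a *\<^sub>R (A - t *\<^sub>R id_blinfun)"
      by (simp add: algebra_simps)
    finally have "invertible_op (a *\<^sub>R (A - t *\<^sub>R id_blinfun))" .
    from invertible_op_scaleR[OF this, of "1 / a"] have "invertible_op (A - t *\<^sub>R id_blinfun)"
      using assms(2) by simp
    with that show False unfolding real_spectrum_iff by simp
  qed
  show ?thesis
  proof (rule has_fun_calcI)
    show "(\<lambda>n. op_poly (pcompose (q n) [:b, a:]) A) \<longlonglongrightarrow> T"
      using q(2) by (simp add: op_poly_pcompose_affine)
    show "uniform_limit (real_spectrum A) (\<lambda>n. poly (pcompose (q n) [:b, a:]))
        (\<lambda>t. f (a * t + b)) sequentially"
    proof (rule uniform_limitI)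
      fix e :: real assume "e > 0"
      from uniform_limitD[OF q(1) this]
      show "\<forall>\<^sub>F n in sequentially. \<forall>t\<in>real_spectrum A.
          dist (poly (pcompose (q n) [:b, a:]) t) (f (a * t + b)) < e"
        by (rule eventually_mono) (use spec in \<open>auto simp: poly_pcompose algebra_simps\<close>)
    qed
  qed
qed

section \<open>Positivity, order and uniqueness\<close>

lemma has_fun_calc_selfadjoint:
  assumes "has_fun_calc A f T" "selfadjoint_op A"
  shows "selfadjoint_op T"
  using assms by (elim has_fun_calcE) (blast intro: selfadjoint_op_tendsto selfadjoint_op_poly)

text \<open>The approximating polynomials are eventually at least \<open>- e\<close> on the
  spectrum. The form bound passes to the limit, and then \<open>e\<close> tends to 0.\<close>

lemma has_fun_calc_nonneg:
  assumes "has_fun_calc A f T" and A: "selfadjoint_op A"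
    and f: "\<And>t. t \<in> real_spectrum A \<Longrightarrow> 0 \<le> f t"
  shows "0 \<le> inner (T x) x"
proof -
  obtain q where q: "uniform_limit (real_spectrum A) (\<lambda>n. poly (q n)) f sequentially"
    "(\<lambda>n. op_poly (q n) A) \<longlonglongrightarrow> T"
    using assms(1) by (elim has_fun_calcE)
  have "- e * (norm x)\<^sup>2 \<le> inner (T x) x" if "e > 0" for e
  proof (rule tendsto_lowerbound)
    show "(\<lambda>n. inner (op_poly (q n) A x) x) \<longlonglongrightarrow> inner (T x) x"
      by (intro tendsto_inner tendsto_const blinfun.tendsto q)
    show "\<forall>\<^sub>F n in sequentially. - e * (norm x)\<^sup>2 \<le> inner (op_poly (q n) A x) x"
      using uniform_limitD[OF q(1) that]
    proof eventually_elim
      case (elim n)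
      show ?case
      proof (rule op_poly_lower_bound[OF A])
        fix t assume t: "t \<in> real_spectrum A"
        then have "dist (poly (q n) t) (f t) < e"
          using elim by blast
        then show "- e \<le> poly (q n) t"
          using f[OF t] by (simp add: dist_real_def abs_less_iff)
      qed
    qed
  qed simp
  then have "\<forall>\<^sub>F e in at_right 0. - e * (norm x)\<^sup>2 \<le> inner (T x) x"
    by (simp add: eventually_at_right_less eventually_at_filter)
  moreover have "((\<lambda>e. - e * (norm x)\<^sup>2) \<longlongrightarrow> - 0 * (norm x)\<^sup>2) (at_right 0)"
    by (intro tendsto_intros)
  ultimately show ?thesis
    using tendsto_upperbound[of "\<lambda>e. - e * (norm x)\<^sup>2" _ "at_right 0"] by simp
qed

lemma has_fun_calc_mono:
  assumes "has_fun_calc A f S" "has_fun_calc A g T" and A: "selfadjoint_op A"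
    and fg: "\<And>t. t \<in> real_spectrum A \<Longrightarrow> f t \<le> g t"
  shows "S \<preceq> T"
proof -
  note d = has_fun_calc_diff[OF assms(2,1)]
  have "0 \<le> inner ((T - S) x) x" for x
    using fg by (intro has_fun_calc_nonneg[OF d A]) simp
  then show ?thesis
    unfolding loewner_le_def positive_op_iff_inner
    using assms(1,2) d A by (blast intro: has_fun_calc_selfadjoint)
qed

text \<open>Monotonicity in both directions makes the quadratic form of \<open>S - T\<close> vanish,
  and a symmetric operator with zero form is zero.\<close>

lemma has_fun_calc_unique:
  assumes "has_fun_calc A f S" "has_fun_calc A f T" and A: "selfadjoint_op A"
  shows "S = T"
proof -
  note le = has_fun_calc_mono[OF assms(1,2) A] has_fun_calc_mono[OF assms(2,1) A]
  have D: "selfadjoint_op (S - T)"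
    using le(2) by (simp add: loewner_le_def positive_op_def)
  have "0 \<le> inner ((T - S) x) x" "0 \<le> inner ((S - T) x) x" for x
    using le by (auto simp: loewner_le_def positive_op_iff_inner)
  then have "inner ((S - T) x) x = 0" for x
    by (simp add: blinfun.diff_left inner_diff_left order_antisym)
  then have "norm ((S - T) x) \<le> 0 * norm x" for x
    by (intro symmetric_norm_le) (auto simp: selfadjoint_opD[OF D])
  then show ?thesis
    by (simp add: blinfun_eq_iff blinfun.diff_left)
qed

lemma fun_calc_eq:
  assumes "has_fun_calc A f T" and A: "selfadjoint_op A"
  shows "fun_calc f A = T"
  unfolding fun_calc_def
proof (rule the_equality)
  show "\<exists>q. uniform_limit (real_spectrum A) (\<lambda>n. poly (q n)) f sequentially \<and>
      (\<lambda>n. op_poly (q n) A) \<longlonglongrightarrow> T"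
    using assms(1) unfolding has_fun_calc_def .
qed (use has_fun_calc_unique[OF _ assms] in \<open>unfold has_fun_calc_def, blast\<close>)

section \<open>Existence for continuous functions and powers\<close>

lemma uniform_poly_approx:
  fixes f :: "real \<Rightarrow> real"
  assumes "continuous_on {a..b} f"
  obtains q where "uniform_limit {a..b} (\<lambda>n. poly (q n)) f sequentially"
proof -
  have "\<exists>q. \<forall>t\<in>{a..b}. \<bar>f t - poly q t\<bar> < inverse (real (Suc n))" for n
  proof -
    obtain g where g: "real_polynomial_function g"
      "\<And>t. t \<in> {a..b} \<Longrightarrow> \<bar>f t - g t\<bar> < inverse (real (Suc n))"
      using Stone_Weierstrass_real_polynomial_function[OF compact_Icc assms,
          of "inverse (real (Suc n))"] by auto
    obtain c k where "g = (\<lambda>x. \<Sum>i\<le>k. c i * x ^ i)"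
      using g(1) real_polynomial_function_iff_sum by blast
    then have "g = poly (\<Sum>i\<le>k. monom (c i) i)"
      by (simp add: poly_sum poly_monom fun_eq_iff)
    with g(2) show ?thesis by blast
  qed
  then obtain q where q: "\<And>n t. t \<in> {a..b} \<Longrightarrow> \<bar>f t - poly (q n) t\<bar> < inverse (real (Suc n))"
    by metis
  have "uniform_limit {a..b} (\<lambda>n. poly (q n)) f sequentially"
  proof (rule uniform_limitI)
    fix e :: real assume "e > 0"
    then have "\<forall>\<^sub>F n in sequentially. inverse (real (Suc n)) < e"
      using LIMSEQ_inverse_real_of_nat by (rule order_tendstoD(2)[rotated])
    then show "\<forall>\<^sub>F n in sequentially. \<forall>t\<in>{a..b}. dist (poly (q n) t) (f t) < e"
      by (rule eventually_mono)
        (use q in \<open>fastforce simp: dist_real_def abs_minus_commute intro: less_trans\<close>)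
  qed
  then show thesis by (rule that)
qed

text \<open>The norm of a polynomial in \<open>A\<close> is bounded by its supremum on the spectrum,
  so uniformly convergent polynomials give a Cauchy sequence of operators.\<close>

lemma has_fun_calc_exists:
  assumes A: "selfadjoint_op A" and f: "continuous_on {a..b} f" and ab: "real_spectrum A \<subseteq> {a..b}"
  shows "has_fun_calc A f (fun_calc f A)"
proof -
  obtain q where "uniform_limit {a..b} (\<lambda>n. poly (q n)) f sequentially"
    using uniform_poly_approx[OF f] .
  then have q: "uniform_limit (real_spectrum A) (\<lambda>n. poly (q n)) f sequentially"
    using ab by (rule uniform_limit_on_subset)
  have "Cauchy (\<lambda>n. op_poly (q n) A)"
  proof (rule metric_CauchyI)
    fix e :: real assume e: "e > 0"
    obtain N where N: "\<And>n t. n \<ge> N \<Longrightarrow> t \<in> real_spectrum A \<Longrightarrow> dist (poly (q n) t) (f t) < e / 4"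
      using q e unfolding uniform_limit_sequentially_iff by (meson divide_pos_pos zero_less_numeral)
    have "dist (op_poly (q m) A) (op_poly (q n) A) < e" if "m \<ge> N" "n \<ge> N" for m n
    proof -
      have "norm (op_poly (q m - q n) A) \<le> e / 2"
      proof (rule norm_op_poly_le[OF A])
        fix t assume "t \<in> real_spectrum A"
        then have "dist (poly (q m) t) (f t) < e / 4" "dist (poly (q n) t) (f t) < e / 4"
          using N that by blast+
        then show "\<bar>poly (q m - q n) t\<bar> \<le> e / 2"
          unfolding dist_real_def poly_diff by linarith
      qed (use e in simp)
      then show ?thesis
        using e by (simp add: op_poly_diff dist_norm)
    qed
    then show "\<exists>N. \<forall>m\<ge>N. \<forall>n\<ge>N. dist (op_poly (q m) A) (op_poly (q n) A) < e"
      by blast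
  qed
  then obtain T where "(\<lambda>n. op_poly (q n) A) \<longlonglongrightarrow> T"
    using Cauchy_convergent_iff convergent_def by blast
  with q have "has_fun_calc A f T"
    by (rule has_fun_calcI)
  with fun_calc_eq[OF this A] show ?thesis by simp
qed

text \<open>The spectrum lies in \<open>{a..norm A}\<close>. There the power is continuous, either
  because 0 is excluded or because the exponent is positive.\<close>

lemma has_fun_calc_powr:
  assumes A: "selfadjoint_op A" and a: "\<And>x. a * (norm x)\<^sup>2 \<le> inner (A x) x"
    and pos: "0 < a \<or> 0 \<le> a \<and> 0 < r"
  shows "has_fun_calc A (\<lambda>t. t powr r) (op_powr A r)"
    and "bounded ((\<lambda>t. t powr r) ` real_spectrum A)"
proof -
  have spec: "real_spectrum A \<subseteq> {a..norm A}"
    using real_spectrum_ge[OF A a] real_spectrum_le_norm[OF A] by force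
  have cont: "continuous_on {a..norm A} (\<lambda>t. t powr r)"
    using pos by (intro continuous_on_powr' continuous_intros) auto
  show "has_fun_calc A (\<lambda>t. t powr r) (op_powr A r)"
    unfolding op_powr_def by (rule has_fun_calc_exists[OF A cont spec])
  show "bounded ((\<lambda>t. t powr r) ` real_spectrum A)"
    using spec by (intro bounded_subset[OF compact_imp_bounded[OF
            compact_continuous_image[OF cont compact_Icc]]]) auto
qed

section \<open>Reduction to the functional calculus\<close>

lemma loewner_le_sandwich:
  assumes "X \<preceq> Y" "selfadjoint_op R"
  shows "R o\<^sub>L X o\<^sub>L R \<preceq> R o\<^sub>L Y o\<^sub>L R"
  unfolding loewner_le_def positive_op_iff_inner
proof (intro conjI allI)
  show X: "selfadjoint_op (R o\<^sub>L X o\<^sub>L R)" and Y: "selfadjoint_op (R o\<^sub>L Y o\<^sub>L R)"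
    using assms by (auto simp: loewner_le_def intro: selfadjoint_op_sandwich)
  show "selfadjoint_op ((R o\<^sub>L Y o\<^sub>L R) - (R o\<^sub>L X o\<^sub>L R))"
    by (rule selfadjoint_op_diff[OF Y X])
  fix x
  have "0 \<le> inner ((Y - X) (R x)) (R x)"
    using assms(1) by (simp add: loewner_le_def positive_op_iff_inner)
  also have "\<dots> = inner (((R o\<^sub>L Y o\<^sub>L R) - (R o\<^sub>L X o\<^sub>L R)) x) x"
    by (simp add: blinfun.bilinear_simps inner_diff_left selfadjoint_opD[OF assms(2)])
  finally show "0 \<le> inner (((R o\<^sub>L Y o\<^sub>L R) - (R o\<^sub>L X o\<^sub>L R)) x) x" .
qed

lemma strictly_positive_op_coercive:
  assumes "strictly_positive_op A"
  obtains a where "a > 0" "\<And>x. a * (norm x)\<^sup>2 \<le> inner (A x) x"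
proof -
  obtain C where C: "C o\<^sub>L A = id_blinfun"
    using assms unfolding strictly_positive_op_def invertible_op_def by blast
  have "selfadjoint_op A" "\<And>x. 0 \<le> inner (A x) x"
    using assms by (auto simp: strictly_positive_op_def positive_op_iff_inner)
  from positive_invertible_coercive[OF selfadjoint_opD(2)[OF this(1)] this(2) C] that
  show thesis by blast
qed

lemma op_powr_half:
  assumes "strictly_positive_op A"
  defines "R \<equiv> op_powr A (1/2)" and "S \<equiv> op_powr A (- (1/2))"
  shows "selfadjoint_op R" "selfadjoint_op S"
    "R o\<^sub>L R = A" "R o\<^sub>L S = id_blinfun" "S o\<^sub>L R = id_blinfun"
proof -
  obtain a where a: "a > 0" "\<And>x. a * (norm x)\<^sup>2 \<le> inner (A x) x"
    using strictly_positive_op_coercive[OF assms(1)] by blast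
  have A: "selfadjoint_op A"
    using assms(1) by (simp add: strictly_positive_op_def positive_op_def)
  have pos: "t > 0" if "t \<in> real_spectrum A" for t
    using real_spectrum_ge[OF A a(2) that] a(1) by simp
  note R = has_fun_calc_powr[OF A a(2), of "1/2", folded R_def]
  note S = has_fun_calc_powr[OF A a(2), of "- (1/2)", folded S_def]
  show "selfadjoint_op R" "selfadjoint_op S"
    using R S A a(1) by (auto intro: has_fun_calc_selfadjoint)
  \<comment> \<open>All three identities are the law of exponents on the positive spectrum,
    transported by the product rule and uniqueness.\<close>
  have prod: "T o\<^sub>L U = V"
    if "has_fun_calc A (\<lambda>t. t powr r) T" "bounded ((\<lambda>t. t powr r) ` real_spectrum A)"
      "has_fun_calc A (\<lambda>t. t powr s) U" "bounded ((\<lambda>t. t powr s) ` real_spectrum A)"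
      "has_fun_calc A f V" "\<And>t. t > 0 \<Longrightarrow> t powr (r + s) = f t" for T U V r s f
  proof -
    have "has_fun_calc A f (T o\<^sub>L U)"
      using has_fun_calc_mult[OF that(1,3,2,4)] that(6) pos
      by (subst has_fun_calc_cong[where g = "\<lambda>t. t powr r * t powr s"]) (auto simp: powr_add)
    then show ?thesis
      by (rule has_fun_calc_unique[OF _ that(5) A])
  qed
  have id: "has_fun_calc A (\<lambda>t. 1) id_blinfun"
    using has_fun_calc_const[of A 1] by simp
  show "R o\<^sub>L R = A"
    using a(1) R by (intro prod[OF _ _ _ _ has_fun_calc_ident]) auto
  show "R o\<^sub>L S = id_blinfun" "S o\<^sub>L R = id_blinfun"
    using a(1) R S by (auto intro!: prod[OF _ _ _ _ id])
qed

lemma op_natural_sandwich: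
  assumes "strictly_positive_op A"
  shows "op_natural r A (op_powr A (1/2) o\<^sub>L Y o\<^sub>L op_powr A (1/2)) =
    op_powr A (1/2) o\<^sub>L op_powr Y r o\<^sub>L op_powr A (1/2)"
proof -
  let ?R = "op_powr A (1/2)" and ?S = "op_powr A (- (1/2))"
  have "?S (?R x) = x" "?R (?S x) = x" for x
    using op_powr_half(4,5)[OF assms] by (auto simp: blinfun_eq_iff)
  then have "?S o\<^sub>L (?R o\<^sub>L Y o\<^sub>L ?R) o\<^sub>L ?S = Y"
    by (simp add: blinfun_eq_iff)
  then show ?thesis
    by (simp add: op_natural_def)
qed

text \<open>The subtracted \<open>A\<close> is \<open>R o\<^sub>L R\<close>, that is, the sandwich
  of the identity.\<close>

lemma tsallis_sandwich:
  assumes "strictly_positive_op A"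
  shows "tsallis r A (op_powr A (1/2) o\<^sub>L Y o\<^sub>L op_powr A (1/2)) =
    op_powr A (1/2) o\<^sub>L (op_powr Y r - id_blinfun) /\<^sub>R r o\<^sub>L op_powr A (1/2)"
proof -
  let ?R = "op_powr A (1/2)"
  have "?R (?R x) = A x" for x
    using op_powr_half(3)[OF assms] by (auto simp: blinfun_eq_iff)
  then show ?thesis
    by (simp add: tsallis_def op_natural_sandwich[OF assms] blinfun_eq_iff blinfun.bilinear_simps)
qed

lemma has_fun_calc_tsallis_log:
  assumes "has_fun_calc C (\<lambda>t. f t powr r) X"
  shows "has_fun_calc C (\<lambda>t. tsallis_log r (f t)) ((X - id_blinfun) /\<^sub>R r)"
  using has_fun_calc_scaleR[OF has_fun_calc_diff[OF assms has_fun_calc_const[of C 1]], of "inverse r"]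
  by (simp add: tsallis_log_def divide_inverse mult.commute)

theorem theorem2p6:
  fixes A B :: "'a :: complex_hilbert_space \<Rightarrow>\<^sub>L 'a" and u v p :: real
  assumes "strictly_positive_op A" and "strictly_positive_op B"
    and "u > 0" and "v > 0" and "u \<ge> 1"
    and "u *\<^sub>R A \<preceq> B" and "B \<preceq> v *\<^sub>R A"
    and "- 1 \<le> p" and "p < 1" and "p \<noteq> 0"
  shows "(tsallis p A B - tsallis (p - 1) A B) /\<^sub>R 2
           \<preceq> 4 *\<^sub>R (tsallis p A ((A + B) /\<^sub>R 2) - tsallis (p - 1) A ((A + B) /\<^sub>R 2))
    \<and> 4 *\<^sub>R (tsallis p A ((A + B) /\<^sub>R 2) - tsallis (p - 1) A ((A + B) /\<^sub>R 2))
           \<preceq> (tsallis p A B - tsallis 1 A B) /\<^sub>R (p - 1)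
    \<and> (tsallis p A B - tsallis 1 A B) /\<^sub>R (p - 1)
           \<preceq> (tsallis p A B - tsallis (p - 1) A B) /\<^sub>R 2 + op_natural 2 A (B - A) /\<^sub>R 4"
proof -
  define R S where "R = op_powr A (1/2)" and "S = op_powr A (- (1/2))"
  note RS = op_powr_half[OF assms(1), folded R_def S_def]
  have RR: "R (R x) = A x" and RS_id: "R (S x) = x" and SR_id: "S (R x) = x" for x
    using RS(3-5) by (auto simp: blinfun_eq_iff)
  have B: "selfadjoint_op B"
    using assms(2) by (simp add: strictly_positive_op_def positive_op_def)
  define C where "C = S o\<^sub>L B o\<^sub>L S"
  have C: "selfadjoint_op C"
    unfolding C_def by (intro selfadjoint_op_sandwich RS B)
  \<comment> \<open>Test \<open>u *\<^sub>R A \<preceq> B\<close> at \<open>S x\<close>: the form of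
    \<open>A\<close> there is \<open>(norm x)\<^sup>2\<close>, that of \<open>B\<close> is the form
    of \<open>C\<close> at \<open>x\<close>, and \<open>u \<ge> 1\<close> finishes.\<close>
  have C_ge: "1 * (norm x)\<^sup>2 \<le> inner (C x) x" for x
  proof -
    have "A (S x) = R x"
      using RR[of "S x"] by (simp add: RS_id)
    then have "inner (A (S x)) (S x) = (norm x)\<^sup>2"
      by (simp add: selfadjoint_opD[OF RS(1)] RS_id power2_norm_eq_inner)
    moreover have "0 \<le> inner ((B - u *\<^sub>R A) (S x)) (S x)"
      using assms(6) by (simp add: loewner_le_def positive_op_iff_inner)
    ultimately have "u * (norm x)\<^sup>2 \<le> inner (C x) x"
      by (simp add: C_def blinfun.bilinear_simps inner_diff_left selfadjoint_opD[OF RS(2)])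
    moreover have "1 * (norm x)\<^sup>2 \<le> u * (norm x)\<^sup>2"
      using assms(5) by (intro mult_right_mono) auto
    ultimately show ?thesis by linarith
  qed
  have spec: "1 \<le> t" if "t \<in> real_spectrum C" for t
    by (rule real_spectrum_ge[OF C C_ge that])

  \<comment> \<open>\<open>M\<close> and \<open>D\<close> correspond to
    \<open>(A + B) /\<^sub>R 2\<close> and \<open>B - A\<close>. Their affine shape, with
    coefficients 1 and \<open>- 1\<close> left visible, matches
    \<open>has_fun_calc_affine\<close>.\<close>
  define M where "M = (1/2) *\<^sub>R C + (1/2) *\<^sub>R id_blinfun"
  define D where "D = 1 *\<^sub>R C + (- 1) *\<^sub>R id_blinfun"
  have MD: "selfadjoint_op M" "selfadjoint_op D"
    unfolding M_def D_def by (intro selfadjoint_op_add selfadjoint_op_scaleR selfadjoint_op_id C)+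
  have M_ge: "1 * (norm x)\<^sup>2 \<le> inner (M x) x" and D_ge: "0 * (norm x)\<^sup>2 \<le> inner (D x) x" for x
    using C_ge[of x] by (simp_all add: M_def D_def blinfun.bilinear_simps inner_add_left
        inner_diff_left dot_square_norm)
  have C_powr: "has_fun_calc C (\<lambda>t. t powr r) (op_powr C r)" for r
    by (rule has_fun_calc_powr(1)[OF C C_ge]) simp
  have M_powr: "has_fun_calc C (\<lambda>t. ((1 + t) / 2) powr r) (op_powr M r)" for r
    using has_fun_calc_affine[OF has_fun_calc_powr(1)[OF MD(1) M_ge, unfolded M_def]]
    by (simp add: M_def add_divide_distrib add.commute)
  \<comment> \<open>\<open>D\<close> need not be invertible, so its lower bound is only 0 and the
    positivity of the exponent 2 is used. The real power is then the square because
    \<open>t \<ge> 1\<close> on the spectrum of \<open>C\<close>.\<close>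
  have "has_fun_calc C (\<lambda>t. (1 * t + - 1) powr 2) (op_powr D 2)"
    unfolding D_def
    by (intro has_fun_calc_affine has_fun_calc_powr(1)[OF MD(2) D_ge, unfolded D_def]) simp_all
  moreover have "(t - 1)\<^sup>2 = (1 * t + - 1) powr 2" if "t \<in> real_spectrum C" for t
    using spec[OF that] by simp
  ultimately have D_powr: "has_fun_calc C (\<lambda>t. (t - 1)\<^sup>2) (op_powr D 2)"
    by (subst has_fun_calc_cong)

  define P where "P r = (op_powr C r - id_blinfun) /\<^sub>R r" for r
  define Q where "Q r = (op_powr M r - id_blinfun) /\<^sub>R r" for r
  have P: "has_fun_calc C (tsallis_log r) (P r)" for r
    unfolding P_def using has_fun_calc_tsallis_log[OF C_powr] .
  have Q: "has_fun_calc C (\<lambda>t. tsallis_log r ((1 + t) / 2)) (Q r)" for r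
    unfolding Q_def using has_fun_calc_tsallis_log[OF M_powr] .

  \<comment> \<open>A linear, order-preserving map through which every operator of the theorem
    factors.\<close>
  define J where "J X = R o\<^sub>L X o\<^sub>L R" for X
  have J: "B = J C" "(A + B) /\<^sub>R 2 = J M" "B - A = J D"
    by (simp_all add: J_def M_def D_def C_def blinfun_eq_iff blinfun.bilinear_simps RR RS_id SR_id
        scaleR_add_right add.commute)
  have tsallis_J: "tsallis r A (J Y) = J ((op_powr Y r - id_blinfun) /\<^sub>R r)"
    and natural_J: "op_natural r A (J Y) = J (op_powr Y r)" for r Y
    unfolding J_def R_def by (rule tsallis_sandwich op_natural_sandwich assms(1))+
  have tsallis: "tsallis r A B = J (P r)" "tsallis r A ((A + B) /\<^sub>R 2) = J (Q r)" for r
    unfolding P_def Q_def tsallis_J[symmetric] J(1,2)[symmetric] by (rule refl)+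
  have natural: "op_natural 2 A (B - A) = J (op_powr D 2)"
    unfolding J(3) by (rule natural_J)
  have J_lin: "J X - J Y = J (X - Y)" "J X + J Y = J (X + Y)" "c *\<^sub>R J X = J (c *\<^sub>R X)" for X Y c
    by (simp_all add: J_def blinfun_eq_iff blinfun.bilinear_simps)
  have J_mono: "J X \<preceq> J Y"
    if "has_fun_calc C f X" "has_fun_calc C g Y" "\<And>t. 1 \<le> t \<Longrightarrow> f t \<le> g t" for f g X Y
    unfolding J_def using that(3) spec
    by (intro loewner_le_sandwich has_fun_calc_mono[OF that(1,2)] C RS) auto

  \<comment> \<open>Resolving with these rules builds the scalar functions left open by
    \<open>J_mono\<close> from the shape of the operators; what remains are the scalar
    inequalities.\<close>
  note calc = has_fun_calc_add has_fun_calc_diff has_fun_calc_scaleR P Q D_powr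
  show ?thesis
    unfolding tsallis natural J_lin
  proof (intro conjI)
    show "J ((P p - P (p - 1)) /\<^sub>R 2) \<preceq> J (4 *\<^sub>R (Q p - Q (p - 1)))"
      by (rule J_mono, (rule calc)+)
        (use tsallis_log_doubling_le[OF assms(9,10)] in \<open>simp add: inverse_eq_divide\<close>)
    show "J (4 *\<^sub>R (Q p - Q (p - 1))) \<preceq> J ((P p - P 1) /\<^sub>R (p - 1))"
      by (rule J_mono, (rule calc)+)
        (use tsallis_log_midpoint_le[OF assms(9,10)] in \<open>simp add: inverse_eq_divide\<close>)
    show "J ((P p - P 1) /\<^sub>R (p - 1)) \<preceq> J ((P p - P (p - 1)) /\<^sub>R 2 + op_powr D 2 /\<^sub>R 4)"
      by (rule J_mono, (rule calc)+)
        (use tsallis_log_le_trapezoid[OF assms(9,10)] in \<open>simp add: inverse_eq_divide\<close>)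
  qed
qed

end
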